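(* Let $m,n,p$ be positive integers with $p \mid mn$. Then \begin{equation*} \begin{split} \nu_{1}(K(p^{(1)},m^{(n)}))=&\frac{1}{24}m^{4}n^{4}+\frac{1}{12}m^{2}n^{3} -\frac{1}{12}m^{4}n^{3}-\frac{1}{4}m^{3}n^{3}+\frac{1}{2}m^{3}n^{2}+\frac{1}{24}m^{4}n^{2} -\frac{1}{4}m^{3}n\\ &+\frac{1}{6}m^{2}n^{2}p^{2}-\frac{1}{4}p^{2}mn-\frac{3}{4}m^{2}n^{2}p +\frac{1}{12}mnp+\frac{1}{2}m^{2}np -\frac{1}{6}m^{3}n^{2}p\\ &+\frac{1}{6}m^{3}n^{3}p +\frac{1}{6}mn^{2}p . \end{split} \end{equation*}
   Context: An outerplanar drawing of a graph $G$ is a drawing in which the vertices are placed on a circle and each edge is drawn as a straight line segment through the interior of the circle, with no more than two edges crossing at any single point. The outerplanar crossing number $\nu_1(G)$ is the minimum number of edge crossings over all outerplanar drawings of $G$. $K(p^{(1)},m^{(n)})$ denotes the complete multipartite graph with $n+1$ partite sets, one of which has $p$ vertices and the other $n$ of which have $m$ vertices each (two vertices are adjacent iff they lie in different partite sets). *)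

theory Defs
  imports "HOL-Analysis.Analysis"
begin

text \<open>A graph is a pair of a vertex set and a set of edges, each edge being the two-element
  set of its endpoints.\<close>

type_synonym 'v ugraph = "'v set \<times> 'v set set"

text \<open>The parameter is the list of the sizes of the partite sets; \<open>(i, j)\<close> is the \<open>j\<close>-th
  vertex of the \<open>i\<close>-th partite set.\<close>

definition complete_multipartite :: "nat list \<Rightarrow> (nat \<times> nat) ugraph" where
  "complete_multipartite ks =
     (let V = {(i, j). i < length ks \<and> j < ks ! i}
      in (V, {{u, v} | u v. u \<in> V \<and> v \<in> V \<and> fst u \<noteq> fst v}))"

text \<open>The relative interior of the segment that represents the edge \<open>e\<close> when each vertex \<open>v\<close>
  is placed at the point \<open>f v\<close>; the endpoints are excluded, so that a common endpoint of two
  edges is not a crossing.\<close>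

definition open_edge :: "('v \<Rightarrow> complex) \<Rightarrow> 'v set \<Rightarrow> complex set" where
  "open_edge f e = {z. \<exists>u v. e = {u, v} \<and> z \<in> open_segment (f u) (f v)}"

definition outerplanar_drawing :: "'v ugraph \<Rightarrow> ('v \<Rightarrow> complex) \<Rightarrow> bool" where
  "outerplanar_drawing G f \<longleftrightarrow>
     inj_on f (fst G) \<and>
     (\<exists>c r. r > 0 \<and> f ` fst G \<subseteq> sphere c r) \<and>
     (\<forall>e1\<in>snd G. \<forall>e2\<in>snd G. \<forall>e3\<in>snd G.
        e1 \<noteq> e2 \<and> e1 \<noteq> e3 \<and> e2 \<noteq> e3 \<longrightarrow>
        open_edge f e1 \<inter> open_edge f e2 \<inter> open_edge f e3 = {})"

definition crossings :: "'v ugraph \<Rightarrow> ('v \<Rightarrow> complex) \<Rightarrow> 'v set set set" where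
  "crossings G f =
     {{e1, e2} | e1 e2. e1 \<in> snd G \<and> e2 \<in> snd G \<and> e1 \<noteq> e2 \<and>
        open_edge f e1 \<inter> open_edge f e2 \<noteq> {}}"

text \<open>Every finite graph has an outerplanar drawing, so for finite graphs this is a minimum
  over a nonempty set.\<close>

definition outerplanar_crossing_number :: "'v ugraph \<Rightarrow> nat" where
  "outerplanar_crossing_number G =
     (LEAST k. \<exists>f. outerplanar_drawing G f \<and> card (crossings G f) = k)"

end

theory Submission
  imports Defs
begin

text \<open>Two chords of a circle cross iff their endpoints interleave. Hence eight times the number of
  crossings counts the quadruples \<open>(a, b, c, d)\<close> of interleaving vertices with \<open>a, b\<close> in different
  parts and \<open>c, d\<close> in different parts. Write \<open>P\<close> for the part of size \<open>p\<close>, \<open>S\<close> for the union of the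
  others, and \<open>ABCD\<close> for the number of interleaving quadruples in \<open>A \<times> B \<times> C \<times> D\<close>.
  Inclusion-exclusion leaves, besides terms depending only on the sizes of the parts,
  \<open>-2 PPSS\<close>, \<open>-iikk\<close>, and sums \<open>-(iixk + kkxi)\<close> over a single point \<open>x\<close> and two parts \<open>i, k\<close> of
  size \<open>m\<close>. Each is bounded separately: \<open>AARR\<close> is maximal when \<open>R\<close> is spread evenly over the gaps
  of \<open>A\<close>, and, after cutting the circle at \<open>x\<close>, \<open>iixk + kkxi\<close> becomes \<open>2 \<Sum> h (2 j + 1 - h)\<close> over
  the points of part \<open>k\<close>, with \<open>j\<close> and \<open>h\<close> the numbers of earlier points of parts \<open>k\<close> and \<open>i\<close>; for
  integer \<open>h\<close> each summand is at most \<open>j (j + 1)\<close>, with equality for \<open>h = j\<close> and \<open>h = j + 1\<close>. If \<open>p\<close> divides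
  \<open>m n\<close>, all bounds are attained at once by the cyclic arrangement of the parts of size \<open>m\<close> with
  the points of \<open>P\<close> inserted at equal distances.\<close>

section \<open>Betweenness on a line\<close>

text \<open>As a strict sign condition this is symmetric in a and b and false when c coincides with
  one of them, so sums may run over whole sets without excluding coincidences.\<close>

definition btw :: "real \<Rightarrow> real \<Rightarrow> real \<Rightarrow> bool" where
  "btw a b c \<longleftrightarrow> (a - c) * (b - c) < 0"

text \<open>For y in A this is the zero-based rank of y; for other y it is the index of the gap of A
  that contains y.\<close>

definition below :: "real set \<Rightarrow> real \<Rightarrow> nat" where
  "below A y = card {a \<in> A. a < y}"

text \<open>With p, q in {0, 1}, the indicator of p \<noteq> q is p + q - 2 p q, so the double sum
  splits into single sums.\<close>

lemma sum_of_bool_neq: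
  assumes "finite A"
  shows "(\<Sum>x\<in>A. \<Sum>y\<in>A. of_bool (P x \<noteq> P y)) =
    2 * real (card {x \<in> A. P x}) * (real (card A) - real (card {x \<in> A. P x}))"
proof -
  let ?p = "\<lambda>x. of_bool (P x) :: real"
  have s: "(\<Sum>x\<in>A. ?p x) = real (card {x \<in> A. P x})"
    using assms by (simp add: Collect_conj_eq Int_commute)
  have "(\<Sum>x\<in>A. \<Sum>y\<in>A. of_bool (P x \<noteq> P y) :: real)
      = (\<Sum>x\<in>A. \<Sum>y\<in>A. ?p x + ?p y - 2 * (?p x * ?p y))"
    by (intro sum.cong) auto
  also have "\<dots> = 2 * real (card A) * (\<Sum>x\<in>A. ?p x) - 2 * (\<Sum>x\<in>A. \<Sum>y\<in>A. ?p x * ?p y)"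
    by (simp only: sum.distrib sum_subtractf sum_distrib_left [symmetric] sum_constant)
  also have "(\<Sum>x\<in>A. \<Sum>y\<in>A. ?p x * ?p y) = (\<Sum>x\<in>A. ?p x) * (\<Sum>x\<in>A. ?p x)"
    by (simp only: sum_product)
  finally show ?thesis
    unfolding s by (simp add: algebra_simps)
qed

text \<open>A smaller element has a strictly smaller initial segment, so ranks are injective;
  counting gives surjectivity. Sums over points thereby become sums over ranks.\<close>

lemma bij_betw_below:
  assumes "finite A"
  shows "bij_betw (below A) A {..<card A}"
proof -
  have less: "below A x < below A y" if "x \<in> A" "y \<in> A" "x < y" for x y
    unfolding below_def using that assms by (intro psubset_card_mono) auto
  have inj: "inj_on (below A) A"
    by (rule inj_onI) (metis less less_irrefl linorder_neqE_linordered_idom)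
  have "below A x < card A" if "x \<in> A" for x
    unfolding below_def using that assms by (intro psubset_card_mono) auto
  then have "below A ` A \<subseteq> {..<card A}" by auto
  moreover have "card (below A ` A) = card {..<card A}"
    using inj by (simp add: card_image)
  ultimately have "below A ` A = {..<card A}"
    by (intro card_subset_eq) auto
  with inj show ?thesis by (simp add: bij_betw_def)
qed

lemma sum_below:
  assumes "finite A"
  shows "(\<Sum>a\<in>A. \<phi> (below A a)) = (\<Sum>j<card A. \<phi> j)"
  using sum.reindex_bij_betw [OF bij_betw_below [OF assms], of \<phi>] .

lemma below_mono: "finite A \<Longrightarrow> x \<le> y \<Longrightarrow> below A x \<le> below A y"
  unfolding below_def by (intro card_mono) auto

lemma card_greater:
  assumes "finite A" "a \<in> A"
  shows "real (card {x \<in> A. a < x}) = real (card A) - 1 - real (below A a)"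
proof -
  have "A = insert a ({x \<in> A. x < a} \<union> {x \<in> A. a < x})" using assms by auto
  then have "card A = card (insert a ({x \<in> A. x < a} \<union> {x \<in> A. a < x}))" by simp
  also have "\<dots> = 1 + (card {x \<in> A. x < a} + card {x \<in> A. a < x})"
    using assms by (subst card_insert_disjoint, simp, simp, subst card_Un_disjoint) auto
  finally show ?thesis by (simp add: below_def)
qed

lemma sum_sgn_diff:
  assumes "finite A" "a \<in> A"
  shows "(\<Sum>x\<in>A. sgn (a - x)) = 2 * real (below A a) - real (card A) + 1"
proof -
  have "(\<Sum>x\<in>A. sgn (a - x)) = (\<Sum>x\<in>A. of_bool (x < a) - of_bool (a < x))"
    by (intro sum.cong) auto
  also have "\<dots> = real (card {x \<in> A. x < a}) - real (card {x \<in> A. a < x})"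
    using assms by (simp add: sum_subtractf Collect_conj_eq Int_commute)
  finally show ?thesis
    using card_greater [OF assms] by (simp add: below_def)
qed

text \<open>Renaming x and y turns the second half of the sum into a copy of the first.\<close>

lemma sum_antisymmetric:
  fixes f :: "'a \<Rightarrow> real"
  assumes anti: "\<And>x y. s x y = - s y x"
  shows "(\<Sum>x\<in>A. \<Sum>y\<in>A. (f x - f y) * s x y) = 2 * (\<Sum>x\<in>A. f x * (\<Sum>y\<in>A. s x y))"
proof -
  have "(\<Sum>x\<in>A. \<Sum>y\<in>A. f y * s x y) = (\<Sum>y\<in>A. \<Sum>x\<in>A. f y * s x y)"
    by (rule sum.swap)
  also have "\<dots> = (\<Sum>y\<in>A. \<Sum>x\<in>A. - (f y * s y x))"
    by (subst anti) simp
  finally have "(\<Sum>x\<in>A. \<Sum>y\<in>A. f y * s x y) = - (\<Sum>x\<in>A. f x * (\<Sum>y\<in>A. s x y))"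
    by (simp add: sum_distrib_left sum_negf)
  then show ?thesis
    by (simp add: left_diff_distrib sum_subtractf sum_distrib_left)
qed

text \<open>For monotone f the absolute value is \<open>(f x - f y) * sgn (x - y)\<close>. By
  antisymmetry only the row sums of \<open>sgn\<close> remain, and these are ranks.\<close>

lemma sum_abs_diff_mono:
  assumes "finite A" and mono: "\<And>x y. x \<in> A \<Longrightarrow> y \<in> A \<Longrightarrow> x \<le> y \<Longrightarrow> f x \<le> (f y :: real)"
  shows "(\<Sum>x\<in>A. \<Sum>y\<in>A. \<bar>f x - f y\<bar>) = 2 * (\<Sum>x\<in>A. f x * (2 * real (below A x) - real (card A) + 1))"
proof -
  have "(\<Sum>x\<in>A. \<Sum>y\<in>A. \<bar>f x - f y\<bar>) = (\<Sum>x\<in>A. \<Sum>y\<in>A. (f x - f y) * sgn (x - y))"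
  proof (intro sum.cong refl)
    fix x y assume "x \<in> A" "y \<in> A"
    then show "\<bar>f x - f y\<bar> = (f x - f y) * sgn (x - y)"
      using mono [of x y] mono [of y x] by (cases x y rule: linorder_cases) auto
  qed
  also have "\<dots> = 2 * (\<Sum>x\<in>A. f x * (\<Sum>y\<in>A. sgn (x - y)))"
    by (rule sum_antisymmetric) (simp add: sgn_minus [symmetric])
  finally show ?thesis
    using assms(1) by (simp add: sum_sgn_diff)
qed

lemma sum_btw_notin:
  assumes "finite A" "c \<notin> A"
  shows "(\<Sum>a\<in>A. \<Sum>b\<in>A. of_bool (btw a b c)) =
    2 * real (below A c) * (real (card A) - real (below A c))"
proof -
  have "(\<Sum>a\<in>A. \<Sum>b\<in>A. of_bool (btw a b c) :: real)
      = (\<Sum>a\<in>A. \<Sum>b\<in>A. of_bool ((a < c) \<noteq> (b < c)))"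
  proof (intro sum.cong refl)
    fix a b assume "a \<in> A" "b \<in> A"
    with assms have "a \<noteq> c" "b \<noteq> c" by auto
    then have "btw a b c \<longleftrightarrow> (a < c) \<noteq> (b < c)"
      unfolding btw_def mult_less_0_iff by auto
    then show "(of_bool (btw a b c) :: real) = of_bool ((a < c) \<noteq> (b < c))" by simp
  qed
  then show ?thesis
    using sum_of_bool_neq [OF assms(1), of "\<lambda>a. a < c"] by (simp add: below_def)
qed

text \<open>The point c contributes nothing as an endpoint, so the count is that for A without c;
  this gives the -1.\<close>

lemma sum_btw_in:
  assumes "finite A" "c \<in> A"
  shows "(\<Sum>a\<in>A. \<Sum>b\<in>A. of_bool (btw a b c)) =
    2 * real (below A c) * (real (card A) - 1 - real (below A c))"
proof -
  have z: "(\<Sum>b\<in>A. of_bool (btw a b c) :: real) = (\<Sum>b\<in>A-{c}. of_bool (btw a b c))" for a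
    using assms by (intro sum.mono_neutral_right) (auto simp: btw_def)
  have "(\<Sum>a\<in>A. \<Sum>b\<in>A. of_bool (btw a b c) :: real) =
      (\<Sum>a\<in>A-{c}. \<Sum>b\<in>A-{c}. of_bool (btw a b c))"
    unfolding z using assms by (intro sum.mono_neutral_right) (auto simp: btw_def)
  also have "\<dots> = 2 * real (below (A-{c}) c) * (real (card (A-{c})) - real (below (A-{c}) c))"
    using assms by (intro sum_btw_notin) auto
  also have "below (A-{c}) c = below A c"
    unfolding below_def by (rule arg_cong [where f = card]) auto
  also have "real (card (A-{c})) = real (card A) - 1"
    using card_Suc_Diff1 [OF assms] by linarith
  finally show ?thesis .
qed

text \<open>The endpoints a, b are ordered, so each unordered pair counts twice. This is what the
  count of \<open>sep a b x c\<close> becomes once the circle is cut at x.\<close>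

definition nbtw :: "real set \<Rightarrow> real set \<Rightarrow> real" where
  "nbtw A C = (\<Sum>a\<in>A. \<Sum>b\<in>A. \<Sum>c\<in>C. of_bool (btw a b c))"

lemma nbtw_swap: "nbtw A C = (\<Sum>c\<in>C. \<Sum>a\<in>A. \<Sum>b\<in>A. of_bool (btw a b c))"
proof -
  have "nbtw A C = (\<Sum>a\<in>A. \<Sum>c\<in>C. \<Sum>b\<in>A. of_bool (btw a b c))"
    unfolding nbtw_def by (rule sum.cong [OF refl]) (rule sum.swap)
  also have "\<dots> = (\<Sum>c\<in>C. \<Sum>a\<in>A. \<Sum>b\<in>A. of_bool (btw a b c))"
    by (rule sum.swap)
  finally show ?thesis .
qed

lemma nbtw_self:
  assumes "finite A"
  shows "nbtw A A = real (card A) * (real (card A) - 1) * (real (card A) - 2) / 3"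
proof -
  \<comment> \<open>The size a in the summand is kept apart from the upper limit m, so that the
    induction can vary m alone.\<close>
  have aux: "(\<Sum>j<m. 2 * real j * (a - 1 - real j)) =
      real m * (real m - 1) * (3 * a - 2 * real m - 2) / 3" for m a
    by (induction m) (auto simp: field_simps)
  have "nbtw A A = (\<Sum>c\<in>A. 2 * real (below A c) * (real (card A) - 1 - real (below A c)))"
    unfolding nbtw_swap using assms by (intro sum.cong refl sum_btw_in)
  also have "\<dots> = (\<Sum>j<card A. 2 * real j * (real (card A) - 1 - real j))"
    by (rule sum_below [OF assms])
  finally show ?thesis unfolding aux by (simp add: field_simps)
qed

lemma sum_btw_eq_abs:
  assumes "finite A" "a \<notin> A" "b \<notin> A"
  shows "(\<Sum>c\<in>A. of_bool (btw a b c)) = \<bar>real (below A a) - real (below A b)\<bar>"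
proof -
  have *: "(\<Sum>c\<in>A. of_bool (btw a b c)) = real (below A b) - real (below A a)"
    if "a \<le> b" "a \<notin> A" "b \<notin> A" for a b
  proof -
    have "(\<Sum>c\<in>A. of_bool (btw a b c) :: real) = (\<Sum>c\<in>A. of_bool (c < b) - of_bool (c < a))"
    proof (intro sum.cong refl)
      fix c assume "c \<in> A"
      with that have "c \<noteq> a" "c \<noteq> b" by auto
      with \<open>a \<le> b\<close> show "(of_bool (btw a b c) :: real) = of_bool (c < b) - of_bool (c < a)"
        unfolding btw_def mult_less_0_iff by auto
    qed
    also have "\<dots> = real (below A b) - real (below A a)"
      using assms by (simp add: sum_subtractf below_def Collect_conj_eq Int_commute)
    finally show ?thesis .
  qed
  have comm: "btw a b c = btw b a c" for c by (simp add: btw_def mult.commute)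
  show ?thesis
  proof (cases "a \<le> b")
    case True
    with * [of a b] assms below_mono [of A a b] show ?thesis by simp
  next
    case False
    with * [of b a] assms below_mono [of A b a] show ?thesis by (simp add: comm)
  qed
qed

text \<open>Let a point c of C have rank j in C and h points of A below it, and let m be the common
  size. It contributes 2 h (m - h) to the first count and, after resolving the absolute values, 2 h
  (2 j - m + 1) to the second. Equal sizes make m cancel.\<close>

lemma nbtw_add_swap:
  assumes "finite A" "finite C" "A \<inter> C = {}" "card A = card C"
  shows "nbtw A C + nbtw C A =
    2 * (\<Sum>c\<in>C. real (below A c) * (2 * real (below C c) + 1 - real (below A c)))"
proof -
  have "nbtw A C = (\<Sum>c\<in>C. 2 * real (below A c) * (real (card C) - real (below A c)))"
    unfolding nbtw_swap using assms by (intro sum.cong refl) (subst sum_btw_notin, auto)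
  moreover have "nbtw C A = (\<Sum>c\<in>C. \<Sum>d\<in>C. \<bar>real (below A c) - real (below A d)\<bar>)"
    unfolding nbtw_def using assms by (intro sum.cong refl sum_btw_eq_abs) auto
  moreover have "\<dots> = 2 * (\<Sum>c\<in>C. real (below A c) * (2 * real (below C c) - real (card C) + 1))"
    using assms by (intro sum_abs_diff_mono) (auto intro: below_mono)
  ultimately show ?thesis
    by (simp add: sum_distrib_left sum.distrib [symmetric] algebra_simps)
qed

lemma sum_pronic: "(\<Sum>j<m. real j * (real j + 1)) = real m * ((real m)\<^sup>2 - 1) / 3"
proof -
  have "3 * (\<Sum>j<m. real j * (real j + 1)) = real m * ((real m)\<^sup>2 - 1)"
  proof (induction m)
    case (Suc m)
    then show ?case by (simp add: power2_eq_square algebra_simps)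
  qed simp
  then show ?thesis by simp
qed

lemma nbtw_add_swap_le:
  assumes "finite A" "finite C" "A \<inter> C = {}" "card A = m" "card C = m"
  shows "nbtw A C + nbtw C A \<le> 2 * real m * ((real m)\<^sup>2 - 1) / 3"
proof -
  have *: "real h * (2 * real j + 1 - real h) \<le> real j * (real j + 1)" for h j :: nat
  proof -
    \<comment> \<open>The defect is a product of two consecutive integers. Over the reals it can be
      negative, hence the passage to \<open>int\<close>.\<close>
    have "0 \<le> (int h - int j) * (int h - int j - 1)"
      by (cases "int h \<le> int j") (auto intro: mult_nonpos_nonpos mult_nonneg_nonneg)
    then have "0 \<le> real_of_int ((int h - int j) * (int h - int j - 1))"
      by (simp only: of_int_0_le_iff)
    then show ?thesis by (simp add: algebra_simps)
  qed
  have "nbtw A C + nbtw C A =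
      2 * (\<Sum>c\<in>C. real (below A c) * (2 * real (below C c) + 1 - real (below A c)))"
    using assms by (intro nbtw_add_swap) auto
  also have "\<dots> \<le> 2 * (\<Sum>c\<in>C. real (below C c) * (real (below C c) + 1))"
    by (intro mult_left_mono sum_mono *) auto
  also have "\<dots> = 2 * (\<Sum>j<m. real j * (real j + 1))"
    using sum_below [OF assms(2), of "\<lambda>j. real j * (real j + 1)"] assms by simp
  finally show ?thesis by (simp add: sum_pronic)
qed

text \<open>The two values in \<open>alt\<close> are the roots of the defect
  \<open>(h - j) * (h - j - 1)\<close>. Both must be allowed, since which of the two parts comes
  first depends on where the circle is cut.\<close>

lemma nbtw_add_swap_eq:
  assumes "finite A" "finite C" "A \<inter> C = {}" "card A = m" "card C = m"
    and alt: "\<And>c. c \<in> C \<Longrightarrow> below A c = below C c \<or> below A c = below C c + 1"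
  shows "nbtw A C + nbtw C A = 2 * real m * ((real m)\<^sup>2 - 1) / 3"
proof -
  have "nbtw A C + nbtw C A =
      2 * (\<Sum>c\<in>C. real (below A c) * (2 * real (below C c) + 1 - real (below A c)))"
    using assms by (intro nbtw_add_swap) auto
  also have "\<dots> = 2 * (\<Sum>c\<in>C. real (below C c) * (real (below C c) + 1))"
    using alt by (intro arg_cong [where f = "\<lambda>x. 2 * x"] sum.cong refl)
      (fastforce simp: algebra_simps)
  also have "\<dots> = 2 * (\<Sum>j<m. real j * (real j + 1))"
    using sum_below [OF assms(2), of "\<lambda>j. real j * (real j + 1)"] assms by simp
  finally show ?thesis by (simp add: sum_pronic)
qed

section \<open>Separation on a circle\<close>

text \<open>The product is negative iff the two pairs interleave, and vanishes if they share a point.\<close>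

definition sep :: "real \<Rightarrow> real \<Rightarrow> real \<Rightarrow> real \<Rightarrow> bool" where
  "sep a b c d \<longleftrightarrow> (a - c) * (a - d) * (b - c) * (b - d) < 0"

text \<open>The reals stand for angles within one period of the circle.\<close>

definition nsep :: "real set \<Rightarrow> real set \<Rightarrow> real set \<Rightarrow> real set \<Rightarrow> real" where
  "nsep A B C D = (\<Sum>a\<in>A. \<Sum>b\<in>B. \<Sum>c\<in>C. \<Sum>d\<in>D. of_bool (sep a b c d))"

lemma sep_flip: "sep a b d c = sep a b c d"
  by (simp add: sep_def mult_ac)

lemma sep_swap: "sep c d a b = sep a b c d"
proof -
  have "(c - a) * (c - b) * (d - a) * (d - b) = (a - c) * (a - d) * (b - c) * (b - d)"
    by algebra
  then show ?thesis by (simp add: sep_def)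
qed

text \<open>The product in \<open>sep\<close> is the product of the two in \<open>btw\<close>;
  neither vanishes, so it is negative iff exactly one of them is.\<close>

lemma sep_iff_btw:
  assumes "c \<noteq> a" "c \<noteq> b" "d \<noteq> a" "d \<noteq> b"
  shows "sep a b c d \<longleftrightarrow> btw a b c \<noteq> btw a b d"
proof -
  have e: "(a - c) * (a - d) * (b - c) * (b - d) = ((a - c) * (b - c)) * ((a - d) * (b - d))"
    by algebra
  have "(a - c) * (b - c) \<noteq> 0" "(a - d) * (b - d) \<noteq> 0" using assms by auto
  then show ?thesis
    unfolding sep_def btw_def e mult_less_0_iff [of "(a - c) * (b - c)"] by linarith
qed

text \<open>A Moebius map sending \<open>x\<close> to infinity cuts the circle open at \<open>x\<close>.\<close>

definition cut_at :: "real \<Rightarrow> real \<Rightarrow> real" where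
  "cut_at x v = - 1 / (v - x)"

text \<open>Up to a positive square, the product of the differences of the images is the product in
  \<open>sep\<close>.\<close>

lemma sep_iff_btw_cut:
  assumes "a \<noteq> x" "b \<noteq> x" "c \<noteq> x"
  shows "sep a b x c \<longleftrightarrow> btw (cut_at x a) (cut_at x b) (cut_at x c)"
proof -
  have *: "cut_at x u - cut_at x c = (u - c) / ((u - x) * (c - x))" if "u \<noteq> x" for u
    using that assms by (simp add: cut_at_def field_simps)
  have "(cut_at x a - cut_at x c) * (cut_at x b - cut_at x c)
      = ((a - x) * (a - c) * (b - x) * (b - c)) / ((a - x) * (b - x) * (c - x))\<^sup>2"
    using assms by (simp add: * power2_eq_square)
  moreover have "((a - x) * (b - x) * (c - x))\<^sup>2 > 0"
    using assms by simp
  ultimately show ?thesis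
    by (simp add: sep_def btw_def divide_less_0_iff)
qed

text \<open>Injective even at x: since \<open>1 / 0 = 0\<close>, the point x goes to 0, which is the
  image of no other point.\<close>

lemma inj_cut: "inj (cut_at x)"
  by (rule injI) (auto simp: cut_at_def)

section \<open>Symmetry and additivity of the separation count\<close>

lemma nsep_flip: "nsep A B D C = nsep A B C D"
proof -
  have "nsep A B D C = (\<Sum>a\<in>A. \<Sum>b\<in>B. \<Sum>c\<in>C. \<Sum>d\<in>D. of_bool (sep a b d c))"
    unfolding nsep_def by (intro sum.cong refl sum.swap)
  then show ?thesis by (simp only: sep_flip nsep_def)
qed

lemma nsep_swap: "nsep C D A B = nsep A B C D"
proof -
  have "nsep C D A B = (\<Sum>c\<in>C. \<Sum>a\<in>A. \<Sum>d\<in>D. \<Sum>b\<in>B. of_bool (sep a b c d))"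
    unfolding nsep_def by (subst sep_swap) (intro sum.cong refl sum.swap)
  also have "\<dots> = (\<Sum>a\<in>A. \<Sum>c\<in>C. \<Sum>b\<in>B. \<Sum>d\<in>D. of_bool (sep a b c d))"
    by (subst sum.swap) (intro sum.cong refl sum.swap)
  also have "\<dots> = nsep A B C D"
    unfolding nsep_def by (intro sum.cong refl sum.swap)
  finally show ?thesis .
qed

lemma nsep_UN3:
  assumes "finite I" "\<And>i. i \<in> I \<Longrightarrow> finite (K i)"
    "\<And>i j. i \<in> I \<Longrightarrow> j \<in> I \<Longrightarrow> i \<noteq> j \<Longrightarrow> K i \<inter> K j = {}"
  shows "nsep A B (\<Union>i\<in>I. K i) D = (\<Sum>i\<in>I. nsep A B (K i) D)"
proof -
  have "nsep A B (\<Union>i\<in>I. K i) D =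
      (\<Sum>a\<in>A. \<Sum>b\<in>B. \<Sum>i\<in>I. \<Sum>c\<in>K i. \<Sum>d\<in>D. of_bool (sep a b c d))"
    unfolding nsep_def using assms by (intro sum.cong refl sum.UNION_disjoint) auto
  also have "\<dots> = (\<Sum>a\<in>A. \<Sum>i\<in>I. \<Sum>b\<in>B. \<Sum>c\<in>K i. \<Sum>d\<in>D. of_bool (sep a b c d))"
    by (intro sum.cong refl sum.swap)
  also have "\<dots> = (\<Sum>i\<in>I. nsep A B (K i) D)"
    unfolding nsep_def by (rule sum.swap)
  finally show ?thesis .
qed

lemma nsep_UN4:
  assumes "finite I" "\<And>i. i \<in> I \<Longrightarrow> finite (K i)"
    "\<And>i j. i \<in> I \<Longrightarrow> j \<in> I \<Longrightarrow> i \<noteq> j \<Longrightarrow> K i \<inter> K j = {}"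
  shows "nsep A B C (\<Union>i\<in>I. K i) = (\<Sum>i\<in>I. nsep A B C (K i))"
  by (subst (1 2) nsep_flip) (rule nsep_UN3 [OF assms])

lemma nsep_Un3:
  assumes "finite C" "finite C'" "C \<inter> C' = {}"
  shows "nsep A B (C \<union> C') D = nsep A B C D + nsep A B C' D"
  unfolding nsep_def using assms by (simp add: sum.union_disjoint sum.distrib)

lemma nsep_Un4:
  assumes "finite D" "finite D'" "D \<inter> D' = {}"
  shows "nsep A B C (D \<union> D') = nsep A B C D + nsep A B C D'"
  by (subst (1 2 3) nsep_flip) (rule nsep_Un3 [OF assms])

lemma nsep_singletons3: "finite C \<Longrightarrow> nsep A B C D = (\<Sum>x\<in>C. nsep A B {x} D)"
  using nsep_UN3 [of C "\<lambda>x. {x}" A B D] by simp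

lemma nsep_singleton_eq_nbtw:
  assumes "x \<notin> A" "x \<notin> C"
  shows "nsep A A {x} C = nbtw (cut_at x ` A) (cut_at x ` C)"
proof -
  have "nbtw (cut_at x ` A) (cut_at x ` C) =
      (\<Sum>a\<in>A. \<Sum>b\<in>A. \<Sum>c\<in>C. of_bool (btw (cut_at x a) (cut_at x b) (cut_at x c)))"
    unfolding nbtw_def by (simp add: sum.reindex inj_on_subset [OF inj_cut])
  also have "\<dots> = (\<Sum>a\<in>A. \<Sum>b\<in>A. \<Sum>c\<in>C. of_bool (sep a b x c))"
  proof (intro sum.cong refl)
    fix a b c assume "a \<in> A" "b \<in> A" "c \<in> C"
    with assms have "a \<noteq> x" "b \<noteq> x" "c \<noteq> x" by auto
    then show "(of_bool (btw (cut_at x a) (cut_at x b) (cut_at x c)) :: real) = of_bool (sep a b x c)"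
      by (simp add: sep_iff_btw_cut)
  qed
  finally show ?thesis by (simp add: nsep_def)
qed

lemma card_cut [simp]: "card (cut_at x ` A) = card A"
  by (intro card_image inj_on_subset [OF inj_cut]) auto

text \<open>This does not depend on positions: after cutting at the point of B, exactly one of any
  three points of A lies between the other two.\<close>

lemma nsep_three_one:
  assumes "finite A" "finite B" "A \<inter> B = {}"
  shows "nsep A A A B = real (card B) * (real (card A) * (real (card A) - 1) * (real (card A) - 2) / 3)"
proof -
  have "nsep A A A B = (\<Sum>x\<in>B. nsep A A {x} A)"
    using assms by (subst nsep_flip) (rule nsep_singletons3)
  also have "\<dots> = (\<Sum>x\<in>B. real (card A) * (real (card A) - 1) * (real (card A) - 2) / 3)"
    using assms by (intro sum.cong refl) (subst nsep_singleton_eq_nbtw, auto simp: nbtw_self)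
  finally show ?thesis by simp
qed

lemma nsep_all:
  assumes "finite A"
  shows "nsep A A A A =
    real (card A) * (real (card A) - 1) * (real (card A) - 2) * (real (card A) - 3) / 3"
proof -
  have "nsep A A A {x} =
      (real (card A) - 1) * (real (card A) - 2) * (real (card A) - 3) / 3" if x: "x \<in> A" for x
  proof -
    let ?B = "A - {x}"
    have z: "sep x b c x = False" "sep a x c x = False" for a b c
      by (auto simp: sep_def)
    \<comment> \<open>Here the product in \<open>sep\<close> is a square.\<close>
    have z3: "sep a b x x = False" for a b
      using zero_le_square [of "(a - x) * (b - x)"] by (simp add: sep_def algebra_simps)
    have "nsep A A A {x} = (\<Sum>a\<in>A. \<Sum>b\<in>A. \<Sum>c\<in>?B. of_bool (sep a b c x))"
      unfolding nsep_def using assms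
      by (intro sum.cong refl sum.mono_neutral_cong_right) (auto simp: z3)
    also have "\<dots> = (\<Sum>a\<in>A. \<Sum>b\<in>?B. \<Sum>c\<in>?B. of_bool (sep a b c x))"
      using assms by (intro sum.cong refl sum.mono_neutral_right) (auto simp: z)
    also have "\<dots> = (\<Sum>a\<in>?B. \<Sum>b\<in>?B. \<Sum>c\<in>?B. of_bool (sep a b c x))"
      using assms by (intro sum.mono_neutral_right) (auto simp: z)
    also have "\<dots> = nsep ?B ?B ?B {x}"
      by (simp add: nsep_def del: sum_of_bool_eq)
    also have "\<dots> = real (card ?B) * (real (card ?B) - 1) * (real (card ?B) - 2) / 3"
      using assms by (subst nsep_three_one) auto
    also have "real (card ?B) = real (card A) - 1"
      using card_Suc_Diff1 [OF assms x] by linarith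
    finally show ?thesis by (simp add: algebra_simps)
  qed
  then have "(\<Sum>x\<in>A. nsep A A A {x}) =
      (\<Sum>x\<in>A. (real (card A) - 1) * (real (card A) - 2) * (real (card A) - 3) / 3)"
    by (intro sum.cong refl)
  moreover have "nsep A A A A = (\<Sum>x\<in>A. nsep A A A {x})"
    by (subst (1 2) nsep_flip) (rule nsep_singletons3 [OF assms])
  ultimately show ?thesis by simp
qed

lemma nsep_singleton_add_swap_le:
  assumes "finite A" "finite C" "A \<inter> C = {}" "card A = m" "card C = m" "x \<notin> A" "x \<notin> C"
  shows "nsep A A {x} C + nsep C C {x} A \<le> 2 * real m * ((real m)\<^sup>2 - 1) / 3"
proof -
  have "cut_at x ` A \<inter> cut_at x ` C = {}"
    using assms(3) image_Int [OF inj_cut, of x A C] by simp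
  then have "nbtw (cut_at x ` A) (cut_at x ` C) + nbtw (cut_at x ` C) (cut_at x ` A)
      \<le> 2 * real m * ((real m)\<^sup>2 - 1) / 3"
    using assms by (intro nbtw_add_swap_le) auto
  then show ?thesis
    using assms by (simp add: nsep_singleton_eq_nbtw)
qed

text \<open>The cut rotates the order: the map is increasing on each side of x, negative after x and
  positive before it. So points after x come first, and a point before x gains all of A minus the
  part before x.\<close>

lemma below_cut:
  assumes "finite A" "x \<notin> A" "c \<noteq> x"
  shows "real (below (cut_at x ` A) (cut_at x c)) =
    real (below A c) - real (below A x) + (if c < x then real (card A) else 0)"
proof -
  have "{v \<in> cut_at x ` A. v < cut_at x c} = cut_at x ` {a \<in> A. cut_at x a < cut_at x c}" by auto
  then have b: "below (cut_at x ` A) (cut_at x c) = card {a \<in> A. cut_at x a < cut_at x c}"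
    by (simp add: below_def)
  show ?thesis
  proof (cases "c < x")
    case True
    have "cut_at x a < cut_at x c \<longleftrightarrow> a < c \<or> x < a" if "a \<in> A" for a
    proof (cases "a < x")
      case a: True
      then show ?thesis using True by (auto simp: cut_at_def field_simps)
    next
      case False
      with that assms have "a > x" by (metis linorder_neqE_linordered_idom)
      then have "cut_at x a < 0" "0 < cut_at x c"
        using True by (auto simp: cut_at_def divide_less_0_iff zero_less_divide_iff)
      then show ?thesis using \<open>a > x\<close> by simp
    qed
    then have "{a \<in> A. cut_at x a < cut_at x c} = {a \<in> A. a < c \<or> x < a}"
      by blast
    also have "\<dots> = {a \<in> A. a < c} \<union> (A - {a \<in> A. a < x})"
      using assms by (auto simp: not_less less_le)
    finally have "card {a \<in> A. cut_at x a < cut_at x c} = card ({a \<in> A. a < c} \<union> (A - {a \<in> A. a < x}))"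
      by (rule arg_cong)
    also have "\<dots> = card {a \<in> A. a < c} + card (A - {a \<in> A. a < x})"
      using assms(1) True by (intro card_Un_disjoint) auto
    also have "real (card (A - {a \<in> A. a < x})) = real (card A) - real (below A x)"
      using assms(1) by (subst card_Diff_subset) (auto simp: below_def of_nat_diff card_mono)
    then have "real (card {a \<in> A. a < c} + card (A - {a \<in> A. a < x})) =
        real (below A c) - real (below A x) + real (card A)"
      by (simp add: below_def)
    finally show ?thesis using True b by simp
  next
    case False
    with assms have cx: "x < c" by simp
    have "cut_at x a < cut_at x c \<longleftrightarrow> a < c \<and> x < a" if "a \<in> A" for a
    proof (cases "a < x")
      case True
      then have "cut_at x a > 0" "0 > cut_at x c"
        using cx by (auto simp: cut_at_def divide_less_0_iff zero_less_divide_iff)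
      then show ?thesis using True by simp
    next
      case False
      with that assms have "a > x" by (metis linorder_neqE_linordered_idom)
      then show ?thesis using cx by (auto simp: cut_at_def field_simps)
    qed
    then have "{a \<in> A. cut_at x a < cut_at x c} = {a \<in> A. a < c \<and> x < a}"
      by blast
    also have "\<dots> = {a \<in> A. a < c} - {a \<in> A. a < x}"
      using assms by (auto simp: not_less less_le)
    finally have "card {a \<in> A. cut_at x a < cut_at x c} = card ({a \<in> A. a < c} - {a \<in> A. a < x})"
      by (rule arg_cong)
    also have "\<dots> = below A c - below A x"
      unfolding below_def using assms(1) cx by (intro card_Diff_subset) auto
    finally have "real (card {a \<in> A. cut_at x a < cut_at x c}) = real (below A c) - real (below A x)"
      using below_mono [OF assms(1), of x c] cx by simp
    then show ?thesis using cx b by simp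
  qed
qed

text \<open>The cut shifts the difference of the two ranks at c by the difference at x, and the
  sizes cancel because they are equal. A difference of 1 at c minus 0 or 1 at x gives 1 or 0, the
  two extremal values.\<close>

lemma nsep_singleton_add_swap_eq:
  assumes "finite A" "finite C" "A \<inter> C = {}" "card A = m" "card C = m" "x \<notin> A" "x \<notin> C"
    and alt: "below A x = below C x \<or> below A x = below C x + 1"
    and alt': "\<And>c. c \<in> C \<Longrightarrow> below A c = below C c + 1"
  shows "nsep A A {x} C + nsep C C {x} A = 2 * real m * ((real m)\<^sup>2 - 1) / 3"
proof -
  have "nbtw (cut_at x ` A) (cut_at x ` C) + nbtw (cut_at x ` C) (cut_at x ` A) = 
    2 * real m * ((real m)\<^sup>2 - 1) / 3"
  proof (rule nbtw_add_swap_eq)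
    show "cut_at x ` A \<inter> cut_at x ` C = {}"
      using assms(3) image_Int [OF inj_cut, of x A C] by simp
    fix v assume "v \<in> cut_at x ` C"
    then obtain c where c: "c \<in> C" "v = cut_at x c" by auto
    have "c \<noteq> x" using c assms by auto
    have "real (below (cut_at x ` A) v) - real (below (cut_at x ` C) v) =
        (real (below A c) - real (below C c)) - (real (below A x) - real (below C x))"
      using assms \<open>c \<noteq> x\<close> by (simp add: c(2) below_cut)
    then show "below (cut_at x ` A) v = below (cut_at x ` C) v \<or>
        below (cut_at x ` A) v = below (cut_at x ` C) v + 1"
      using alt alt' [OF c(1)] by auto
  qed (use assms in auto)
  then show ?thesis
    using assms by (simp add: nsep_singleton_eq_nbtw)
qed

text \<open>If d points of R lie between x and y, then exactly the pairs taking one of these d and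
  one of the other b - d interleave with x, y: \<open>2 * d * (b - d)\<close> ordered pairs.\<close>

lemma nsep_two_two:
  assumes "finite A" "finite R" "A \<inter> R = {}" "card R = b"
  shows "nsep A A R R = 2 * (\<Sum>x\<in>A. \<Sum>y\<in>A.
    real b * \<bar>real (below R x) - real (below R y)\<bar> - (real (below R x) - real (below R y))\<^sup>2)"
proof -
  have "(\<Sum>r\<in>R. \<Sum>s\<in>R. of_bool (sep x y r s)) =
      2 * (real b * \<bar>real (below R x) - real (below R y)\<bar> - (real (below R x) - real (below R y))\<^sup>2)"
    if "x \<in> A" "y \<in> A" for x y
  proof -
    have "x \<notin> R" "y \<notin> R" using that assms by auto
    then have "(\<Sum>r\<in>R. \<Sum>s\<in>R. of_bool (sep x y r s) :: real) =
        (\<Sum>r\<in>R. \<Sum>s\<in>R. of_bool (btw x y r \<noteq> btw x y s))"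
      by (intro sum.cong refl) (subst sep_iff_btw, auto)
    also have "\<dots> = 2 * real (card {r \<in> R. btw x y r}) * (real b - real (card {r \<in> R. btw x y r}))"
      using sum_of_bool_neq [OF assms(2), of "btw x y"] assms by simp
    also have "real (card {r \<in> R. btw x y r}) = (\<Sum>r\<in>R. of_bool (btw x y r))"
      using assms by (simp add: Collect_conj_eq Int_commute)
    also have "\<dots> = \<bar>real (below R x) - real (below R y)\<bar>"
      using assms \<open>x \<notin> R\<close> \<open>y \<notin> R\<close> by (intro sum_btw_eq_abs)
    finally show ?thesis by (simp add: algebra_simps power2_eq_square abs_mult_self_eq)
  qed
  then show ?thesis
    unfolding nsep_def sum_distrib_left by (intro sum.cong refl) blast
qed

lemma sum_below_eq:
  assumes "finite A" "card A = a"
  shows "(\<Sum>x\<in>A. real (below A x)) = real a * (real a - 1) / 2"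
    and "(\<Sum>x\<in>A. (real (below A x))\<^sup>2) = real a * (real a - 1) * (2 * real a - 1) / 6"
proof -
  have "(\<Sum>j<a. real j) = real a * (real a - 1) / 2"
    by (induction a) (auto simp: field_simps)
  then show "(\<Sum>x\<in>A. real (below A x)) = real a * (real a - 1) / 2"
    using sum_below [OF assms(1), of real] assms(2) by simp
  have "(\<Sum>j<a. (real j)\<^sup>2) = real a * (real a - 1) * (2 * real a - 1) / 6"
    by (induction a) (auto simp: field_simps power2_eq_square)
  then show "(\<Sum>x\<in>A. (real (below A x))\<^sup>2) = real a * (real a - 1) * (2 * real a - 1) / 6"
    using sum_below [OF assms(1), of "\<lambda>j. (real j)\<^sup>2"] assms(2) by simp
qed

text \<open>The deviation \<open>e\<close> of \<open>below R\<close> from the linear function of the rank with slope \<open>b / a\<close>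
  enters only through its variance: the linear terms in \<open>e\<close> cancel.\<close>

lemma nsep_two_two_deviation:
  assumes "finite A" "finite R" "A \<inter> R = {}" "card A = a" "card R = b" "a > 0"
  defines "e \<equiv> \<lambda>x. real (below R x) - real (below A x) * real b / real a"
  shows "nsep A A R R = (real b)\<^sup>2 * ((real a)\<^sup>2 - 1) / 3 - 2 * (\<Sum>x\<in>A. \<Sum>y\<in>A. (e x - e y)\<^sup>2)"
proof -
  define \<beta> where "\<beta> = real b / real a"
  define G where "G = (\<lambda>x. real (below R x))"
  define j where "j = (\<lambda>x. real (below A x))"
  have ba: "real b = \<beta> * real a" using assms by (simp add: \<beta>_def)
  have G: "G x = e x + \<beta> * j x" for x by (simp add: e_def \<beta>_def G_def j_def)
  have s1: "(\<Sum>x\<in>A. j x) = real a * (real a - 1) / 2"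
    and s2: "(\<Sum>x\<in>A. (j x)\<^sup>2) = real a * (real a - 1) * (2 * real a - 1) / 6"
    using sum_below_eq [of A a] assms by (auto simp: j_def)
  have abs: "(\<Sum>x\<in>A. \<Sum>y\<in>A. \<bar>G x - G y\<bar>) = 2 * (\<Sum>x\<in>A. G x * (2 * j x - real a + 1))"
    unfolding G_def j_def using assms by (subst sum_abs_diff_mono) (auto intro: below_mono)
  \<comment> \<open>The variance identity, stated for arbitrary h because it serves both
    \<open>G\<close> and \<open>e\<close>.\<close>
  have sq: "(\<Sum>x\<in>A. \<Sum>y\<in>A. (h x - h y)\<^sup>2) = 2 * real a * (\<Sum>x\<in>A. (h x)\<^sup>2) - 2 * (\<Sum>x\<in>A. h x)\<^sup>2"
    for h :: "real \<Rightarrow> real"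
  proof -
    have "(\<Sum>x\<in>A. \<Sum>y\<in>A. (h x - h y)\<^sup>2) = (\<Sum>x\<in>A. \<Sum>y\<in>A. (h x)\<^sup>2 + (h y)\<^sup>2 - 2 * (h x * h y))"
      by (simp add: power2_eq_square algebra_simps)
    also have "\<dots> = 2 * real a * (\<Sum>x\<in>A. (h x)\<^sup>2) - 2 * (\<Sum>x\<in>A. \<Sum>y\<in>A. h x * h y)"
      using assms by (simp only: sum.distrib sum_subtractf sum_distrib_left [symmetric] sum_constant)
    also have "(\<Sum>x\<in>A. \<Sum>y\<in>A. h x * h y) = (\<Sum>x\<in>A. h x)\<^sup>2"
      by (simp add: sum_product power2_eq_square)
    finally show ?thesis .
  qed
  define E1 where "E1 = (\<Sum>x\<in>A. e x)"
  define E2 where "E2 = (\<Sum>x\<in>A. (e x)\<^sup>2)"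
  define EJ where "EJ = (\<Sum>x\<in>A. e x * j x)"
  have g1: "(\<Sum>x\<in>A. G x) = E1 + \<beta> * (real a * (real a - 1) / 2)"
    by (simp add: G E1_def sum.distrib sum_distrib_left [symmetric] s1)
  have g2: "(\<Sum>x\<in>A. (G x)\<^sup>2) = E2 + 2 * \<beta> * EJ + \<beta>\<^sup>2 * (real a * (real a - 1) * (2 * real a - 1) / 6)"
    unfolding s2 [symmetric] by (simp add: G E2_def EJ_def power2_eq_square algebra_simps sum.distrib sum_distrib_left)
  have gj: "(\<Sum>x\<in>A. G x * j x) = EJ + \<beta> * (real a * (real a - 1) * (2 * real a - 1) / 6)"
    unfolding s2 [symmetric] by (simp add: G EJ_def power2_eq_square algebra_simps sum.distrib sum_distrib_left)
  have lin: "(\<Sum>x\<in>A. G x * (2 * j x - real a + 1)) = 2 * (\<Sum>x\<in>A. G x * j x) - (real a - 1) * (\<Sum>x\<in>A. G x)"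
    by (simp add: algebra_simps sum.distrib sum_subtractf sum_distrib_left)
  have "nsep A A R R = 2 * (\<Sum>x\<in>A. \<Sum>y\<in>A. real b * \<bar>G x - G y\<bar> - (G x - G y)\<^sup>2)"
    unfolding G_def using assms by (intro nsep_two_two)
  also have "\<dots> = 2 * (real b * (\<Sum>x\<in>A. \<Sum>y\<in>A. \<bar>G x - G y\<bar>) - (\<Sum>x\<in>A. \<Sum>y\<in>A. (G x - G y)\<^sup>2))"
    by (simp add: sum_subtractf sum_distrib_left)
  \<comment> \<open>Since b = \<beta> a, \<open>EJ\<close> cancels between the absolute and the
    quadratic part, and of \<open>E1\<close> only the square survives.\<close>
  also have "\<dots> = (real b)\<^sup>2 * ((real a)\<^sup>2 - 1) / 3 - 2 * (2 * real a * E2 - 2 * E1\<^sup>2)"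
    unfolding abs lin sq g1 g2 gj ba by (simp add: power2_eq_square field_simps)
  finally show ?thesis
    by (simp add: sq E1_def E2_def)
qed

lemma nsep_two_two_le:
  assumes "finite A" "finite R" "A \<inter> R = {}" "card A = a" "card R = b" "a > 0"
  shows "nsep A A R R \<le> (real b)\<^sup>2 * ((real a)\<^sup>2 - 1) / 3"
  unfolding nsep_two_two_deviation [OF assms] by (simp add: sum_nonneg)

text \<open>A common offset k is harmless, as only differences of deviations enter. Offsets 0 and 1
  both occur later.\<close>

lemma nsep_two_two_eq:
  assumes "finite A" "finite R" "A \<inter> R = {}" "card A = a" "card R = b" "a > 0"
    and lin: "\<And>x. x \<in> A \<Longrightarrow> real (below R x) = k + real (below A x) * real b / real a"
  shows "nsep A A R R = (real b)\<^sup>2 * ((real a)\<^sup>2 - 1) / 3"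
  unfolding nsep_two_two_deviation [OF assms(1-6)] using lin by simp

section \<open>Bounding the crossing sum\<close>

text \<open>Eight times the number of crossings: each chord has two orders of its endpoints, and the
  two chords can be exchanged. Index 0 is the part \<open>P\<close>.\<close>

definition crossing_sum :: "nat \<Rightarrow> (nat \<Rightarrow> real set) \<Rightarrow> real" where
  "crossing_sum n K = (\<Sum>i\<le>n. \<Sum>j\<le>n. \<Sum>k\<le>n. \<Sum>l\<le>n.
     of_bool (i \<noteq> j \<and> k \<noteq> l) * nsep (K i) (K j) (K k) (K l))"

lemma sum_off_diagonal:
  assumes "finite I"
  shows "(\<Sum>i\<in>I. \<Sum>j\<in>I. of_bool (i \<noteq> j) * f i j) = (\<Sum>i\<in>I. \<Sum>j\<in>I. f i j) - (\<Sum>i\<in>I. f i i :: real)"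
proof -
  have "(\<Sum>j\<in>I. of_bool (i \<noteq> j) * f i j) = (\<Sum>j\<in>I. f i j) - f i i" if "i \<in> I" for i
  proof -
    have "(\<Sum>j\<in>I. of_bool (i \<noteq> j) * f i j) = (\<Sum>j\<in>I. f i j - (if i = j then f i j else 0))"
      by (intro sum.cong) auto
    also have "\<dots> = (\<Sum>j\<in>I. f i j) - f i i"
      using assms that by (simp add: sum_subtractf)
    finally show ?thesis .
  qed
  then show ?thesis by (simp add: sum_subtractf)
qed

text \<open>The sets of angles of the parts, detached from any drawing. Finiteness and disjointness
  are asked for all indices; in the applications the sets beyond n are empty.\<close>

locale point_parts =
  fixes K :: "nat \<Rightarrow> real set" and m n p :: nat
  assumes finite_K: "finite (K i)"
    and card_K0: "card (K 0) = p"
    and card_K: "i \<in> {1..n} \<Longrightarrow> card (K i) = m"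
    and disjoint_K: "i \<noteq> j \<Longrightarrow> K i \<inter> K j = {}"
    and m_pos: "m > 0" and p_pos: "p > 0"
begin

definition S :: "real set" where "S = (\<Union>i\<in>{1..n}. K i)"

lemma finite_S: "finite S"
  by (simp add: S_def finite_K)

lemma card_S: "card S = m * n"
proof -
  have "card S = (\<Sum>i\<in>{1..n}. card (K i))"
    unfolding S_def using finite_K disjoint_K by (intro card_UN_disjoint) auto
  then show ?thesis by (simp add: card_K)
qed

lemma K0_S: "K 0 \<inter> S = {}"
proof (rule equals0I)
  fix x assume x: "x \<in> K 0 \<inter> S"
  then obtain i where "i \<in> {1..n}" "x \<in> K i" by (auto simp: S_def)
  then show False using x disjoint_K [of 0 i] by auto
qed

lemma UN_K: "(\<Union>i\<le>n. K i) = K 0 \<union> S"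
proof -
  have "{..n} = insert 0 {1..n}" by auto
  then show ?thesis by (simp add: S_def)
qed

lemma nsep_parts3: "finite I \<Longrightarrow> nsep A B (\<Union>i\<in>I. K i) D = (\<Sum>i\<in>I. nsep A B (K i) D)"
  by (rule nsep_UN3 [OF _ finite_K disjoint_K])

lemma nsep_parts4: "finite I \<Longrightarrow> nsep A B C (\<Union>i\<in>I. K i) = (\<Sum>i\<in>I. nsep A B C (K i))"
  by (rule nsep_UN4 [OF _ finite_K disjoint_K])

text \<open>Inclusion-exclusion over i = j and k = l. The two single corrections agree because the
  chords can be exchanged, hence the factor 2.\<close>

lemma crossing_sum_eq:
  "crossing_sum n K = nsep (K 0 \<union> S) (K 0 \<union> S) (K 0 \<union> S) (K 0 \<union> S)
    - 2 * (\<Sum>i\<le>n. nsep (K i) (K i) (K 0 \<union> S) (K 0 \<union> S))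
    + (\<Sum>i\<le>n. \<Sum>k\<le>n. nsep (K i) (K i) (K k) (K k))"
proof -
  let ?V = "\<Union>i\<le>n. K i"
  let ?f = "\<lambda>i j. \<Sum>k\<le>n. \<Sum>l\<le>n. of_bool (k \<noteq> l) * nsep (K i) (K j) (K k) (K l)"
  have VV: "(\<Sum>k\<le>n. \<Sum>l\<le>n. nsep A B (K k) (K l)) = nsep A B ?V ?V" for A B
    by (subst nsep_parts3) (simp_all only: nsep_parts4 finite_atMost)
  have f: "?f i j = nsep (K i) (K j) ?V ?V - (\<Sum>k\<le>n. nsep (K i) (K j) (K k) (K k))" for i j
    by (subst sum_off_diagonal) (simp_all only: VV finite_atMost)
  have "crossing_sum n K = (\<Sum>i\<le>n. \<Sum>j\<le>n. of_bool (i \<noteq> j) * ?f i j)"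
    unfolding crossing_sum_def sum_distrib_left
    by (intro sum.cong refl) (simp add: of_bool_conj)
  also have "\<dots> = (\<Sum>i\<le>n. \<Sum>j\<le>n. ?f i j) - (\<Sum>i\<le>n. ?f i i)"
    by (subst sum_off_diagonal) simp_all
  also have "(\<Sum>i\<le>n. \<Sum>j\<le>n. ?f i j) =
      (\<Sum>i\<le>n. \<Sum>j\<le>n. nsep (K i) (K j) ?V ?V) - (\<Sum>i\<le>n. \<Sum>j\<le>n. \<Sum>k\<le>n. nsep (K i) (K j) (K k) (K k))"
    unfolding f by (simp only: sum_subtractf)
  also have "(\<Sum>i\<le>n. \<Sum>j\<le>n. nsep (K i) (K j) ?V ?V) = nsep ?V ?V ?V ?V"
    by (subst nsep_swap) (simp only: VV)
  also have "(\<Sum>i\<le>n. \<Sum>j\<le>n. \<Sum>k\<le>n. nsep (K i) (K j) (K k) (K k)) =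
      (\<Sum>k\<le>n. \<Sum>i\<le>n. \<Sum>j\<le>n. nsep (K k) (K k) (K i) (K j))"
  proof -
    have "(\<Sum>i\<le>n. \<Sum>j\<le>n. \<Sum>k\<le>n. nsep (K i) (K j) (K k) (K k)) =
       (\<Sum>i\<le>n. \<Sum>k\<le>n. \<Sum>j\<le>n. nsep (K i) (K j) (K k) (K k))"
      by (intro sum.cong refl sum.swap)
    also have "\<dots> = (\<Sum>k\<le>n. \<Sum>i\<le>n. \<Sum>j\<le>n. nsep (K i) (K j) (K k) (K k))"
      by (rule sum.swap)
    finally show ?thesis by (subst nsep_swap)
  qed
  also have "\<dots> = (\<Sum>i\<le>n. nsep (K i) (K i) ?V ?V)"
    by (simp only: VV)
  also have "(\<Sum>i\<le>n. ?f i i) = (\<Sum>i\<le>n. nsep (K i) (K i) ?V ?V) -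
      (\<Sum>i\<le>n. \<Sum>k\<le>n. nsep (K i) (K i) (K k) (K k))"
    unfolding f by (simp only: sum_subtractf)
  finally show ?thesis
    unfolding UN_K by simp
qed

definition T :: "nat \<Rightarrow> real \<Rightarrow> nat \<Rightarrow> real" where
  "T i x k = nsep (K i) (K i) {x} (K k) + nsep (K k) (K k) {x} (K i)"

text \<open>Symmetrised in i and k like \<open>T\<close>. The subtracted diagonal is the term
  \<open>iikk\<close> that inclusion-exclusion gives back.\<close>

definition Z :: "nat \<Rightarrow> nat \<Rightarrow> nat \<Rightarrow> real" where
  "Z i l k = nsep (K i) (K i) (K l) (K k) + nsep (K k) (K k) (K l) (K i)
    - of_bool (k = l) * nsep (K i) (K i) (K l) (K k)"

text \<open>Both halves of \<open>T\<close> have the same sum after renaming i and k; the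
  symmetrised form is the one for which a bound is available.\<close>

lemma sum_nsep_P_S:
  "2 * (\<Sum>i\<in>{1..n}. nsep (K i) (K i) (K 0) S) = (\<Sum>x\<in>K 0. \<Sum>i\<in>{1..n}. \<Sum>k\<in>{1..n}. T i x k)"
proof -
  let ?t = "\<lambda>x i k. nsep (K i) (K i) {x} (K k)"
  have "(\<Sum>i\<in>{1..n}. nsep (K i) (K i) (K 0) S) = (\<Sum>i\<in>{1..n}. \<Sum>x\<in>K 0. \<Sum>k\<in>{1..n}. ?t x i k)"
    unfolding S_def by (subst nsep_singletons3 [OF finite_K]) (simp only: nsep_parts4 finite_atLeastAtMost)
  also have "\<dots> = (\<Sum>x\<in>K 0. \<Sum>i\<in>{1..n}. \<Sum>k\<in>{1..n}. ?t x i k)"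
    by (rule sum.swap)
  finally have *: "(\<Sum>i\<in>{1..n}. nsep (K i) (K i) (K 0) S) = \<dots>" .
  have "(\<Sum>x\<in>K 0. \<Sum>i\<in>{1..n}. \<Sum>k\<in>{1..n}. T i x k) =
      (\<Sum>x\<in>K 0. \<Sum>i\<in>{1..n}. \<Sum>k\<in>{1..n}. ?t x i k) + (\<Sum>x\<in>K 0. \<Sum>i\<in>{1..n}. \<Sum>k\<in>{1..n}. ?t x k i)"
    by (simp only: T_def sum.distrib)
  also have "(\<Sum>x\<in>K 0. \<Sum>i\<in>{1..n}. \<Sum>k\<in>{1..n}. ?t x k i) = (\<Sum>x\<in>K 0. \<Sum>i\<in>{1..n}. \<Sum>k\<in>{1..n}. ?t x i k)"
    by (intro sum.cong refl sum.swap)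
  finally show ?thesis using * by simp
qed

lemma sum_nsep_S_S:
  "2 * (\<Sum>i\<in>{1..n}. nsep (K i) (K i) S S) - (\<Sum>i\<in>{1..n}. \<Sum>k\<in>{1..n}. nsep (K i) (K i) (K k) (K k)) =
    (\<Sum>i\<in>{1..n}. \<Sum>l\<in>{1..n}. \<Sum>k\<in>{1..n}. Z i l k)"
proof -
  let ?w = "\<lambda>i l k. nsep (K i) (K i) (K l) (K k)"
  have *: "(\<Sum>i\<in>{1..n}. nsep (K i) (K i) S S) = (\<Sum>i\<in>{1..n}. \<Sum>l\<in>{1..n}. \<Sum>k\<in>{1..n}. ?w i l k)"
    unfolding S_def by (subst nsep_parts3) (simp_all only: nsep_parts4 finite_atLeastAtMost)
  have sw: "(\<Sum>i\<in>{1..n}. \<Sum>l\<in>{1..n}. \<Sum>k\<in>{1..n}. ?w k l i) = (\<Sum>i\<in>{1..n}. \<Sum>l\<in>{1..n}. \<Sum>k\<in>{1..n}. ?w i l k)"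
  proof -
    have "(\<Sum>i\<in>{1..n}. \<Sum>l\<in>{1..n}. \<Sum>k\<in>{1..n}. ?w k l i) = (\<Sum>i\<in>{1..n}. \<Sum>k\<in>{1..n}. \<Sum>l\<in>{1..n}. ?w k l i)"
      by (intro sum.cong refl sum.swap)
    also have "\<dots> = (\<Sum>k\<in>{1..n}. \<Sum>i\<in>{1..n}. \<Sum>l\<in>{1..n}. ?w k l i)"
      by (rule sum.swap)
    also have "\<dots> = (\<Sum>k\<in>{1..n}. \<Sum>l\<in>{1..n}. \<Sum>i\<in>{1..n}. ?w k l i)"
      by (intro sum.cong refl sum.swap)
    finally show ?thesis .
  qed
  have d: "(\<Sum>k\<in>{1..n}. of_bool (k = l) * ?w i l k) = ?w i l l" if "l \<in> {1..n}" for i l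
  proof -
    have "(\<Sum>k\<in>{1..n}. of_bool (k = l) * ?w i l k) = (\<Sum>k\<in>{1..n}. if k = l then ?w i l k else 0)"
      by (intro sum.cong) auto
    then show ?thesis using that by simp
  qed
  have "(\<Sum>i\<in>{1..n}. \<Sum>l\<in>{1..n}. \<Sum>k\<in>{1..n}. Z i l k) =
      (\<Sum>i\<in>{1..n}. \<Sum>l\<in>{1..n}. \<Sum>k\<in>{1..n}. ?w i l k) + (\<Sum>i\<in>{1..n}. \<Sum>l\<in>{1..n}. \<Sum>k\<in>{1..n}. ?w k l i)
      - (\<Sum>i\<in>{1..n}. \<Sum>l\<in>{1..n}. \<Sum>k\<in>{1..n}. of_bool (k = l) * ?w i l k)"
    by (simp only: Z_def sum.distrib sum_subtractf)
  also have "(\<Sum>i\<in>{1..n}. \<Sum>l\<in>{1..n}. \<Sum>k\<in>{1..n}. of_bool (k = l) * ?w i l k) =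
      (\<Sum>i\<in>{1..n}. \<Sum>k\<in>{1..n}. ?w i k k)"
    by (intro sum.cong refl d)
  finally show ?thesis unfolding * sw by simp
qed

text \<open>At natural a, \<open>N3 a\<close> is 2 (a choose 3) and \<open>N4 a\<close> is 8 (a
  choose 4), the position-free counts; \<open>2 * U m\<close> is the extremal value of
  \<open>T\<close> for different parts of size m.\<close>

definition N3 :: "real \<Rightarrow> real" where "N3 a = a * (a - 1) * (a - 2) / 3"
definition N4 :: "real \<Rightarrow> real" where "N4 a = a * (a - 1) * (a - 2) * (a - 3) / 3"
definition U :: "real \<Rightarrow> real" where "U a = a * (a\<^sup>2 - 1) / 3"

text \<open>The terms \<open>iiPP\<close> are subtracted twice and added back twice, so they cancel.
  What still depends on positions enters with negative sign, so upper bounds on it bound the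
  crossings from below.\<close>

lemma crossing_sum_decomposition:
  "crossing_sum n K = N4 (real m * real n + real p) - N4 p - 4 * real m * real n * N3 p
    - 2 * nsep (K 0) (K 0) S S
    - 2 * (\<Sum>x\<in>K 0. \<Sum>i\<in>{1..n}. \<Sum>k\<in>{1..n}. T i x k)
    - (\<Sum>i\<in>{1..n}. \<Sum>l\<in>{1..n}. \<Sum>k\<in>{1..n}. Z i l k)"
proof -
  let ?P = "K 0"
  have split: "(\<Sum>i\<le>n. g i) = g 0 + (\<Sum>i\<in>{1..n}. g i)" for g :: "nat \<Rightarrow> real"
  proof -
    have "{..n} = insert 0 {1..n}" by auto
    then show ?thesis by simp
  qed
  have VV: "nsep A A (?P \<union> S) (?P \<union> S) = nsep A A ?P ?P + 2 * nsep A A ?P S + nsep A A S S" for A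
    using nsep_flip [of A A S ?P] finite_S K0_S finite_K
    by (simp add: nsep_Un3 nsep_Un4)
  have "card (?P \<union> S) = m * n + p"
    using K0_S finite_S finite_K by (simp add: card_Un_disjoint card_S card_K0)
  then have V: "nsep (?P \<union> S) (?P \<union> S) (?P \<union> S) (?P \<union> S) = N4 (real m * real n + real p)"
    using finite_S finite_K by (subst nsep_all) (auto simp: N4_def)
  have P4: "nsep ?P ?P ?P ?P = N4 p"
    using finite_K by (subst nsep_all) (auto simp: N4_def card_K0)
  have P3: "nsep ?P ?P ?P S = real m * real n * N3 p"
    using finite_K finite_S K0_S by (subst nsep_three_one) (auto simp: N3_def card_K0 card_S)
  have PK: "(\<Sum>k\<in>{1..n}. nsep ?P ?P (K k) (K k)) = (\<Sum>k\<in>{1..n}. nsep (K k) (K k) ?P ?P)"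
    by (rule sum.cong [OF refl nsep_swap])
  have "(\<Sum>i\<le>n. \<Sum>k\<le>n. nsep (K i) (K i) (K k) (K k)) =
      nsep ?P ?P ?P ?P + 2 * (\<Sum>i\<in>{1..n}. nsep (K i) (K i) ?P ?P)
      + (\<Sum>i\<in>{1..n}. \<Sum>k\<in>{1..n}. nsep (K i) (K i) (K k) (K k))"
    unfolding split PK sum.distrib by simp
  then show ?thesis
    unfolding crossing_sum_eq V
    unfolding split sum_nsep_P_S [symmetric] sum_nsep_S_S [symmetric] VV
    by (simp add: P4 P3 sum.distrib sum_distrib_left [symmetric])
qed
end

section \<open>The lower bound and its equality case\<close>

context point_parts
begin

definition T_bound :: "nat \<Rightarrow> nat \<Rightarrow> real" where
  "T_bound i k = (if i = k then 2 * N3 m else 2 * U m)"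

text \<open>Only the last two branches are genuine bounds: in the first of them \<open>kkii\<close>
  is bounded by even spreading, in the other each of the m points of part l contributes the bound on
  \<open>T\<close>.\<close>

definition Z_bound :: "nat \<Rightarrow> nat \<Rightarrow> nat \<Rightarrow> real" where
  "Z_bound i l k =
    (if i = k then (if l = i then N4 m else 2 * real m * N3 m)
     else if k = l then real m * N3 m
     else if i = l then real m * N3 m + real m * U m
     else 2 * real m * U m)"

text \<open>The decomposition with the position-dependent sums replaced by their bounds; n (n - 1)
  and n (n - 1) (n - 2) count the pairs and triples of distinct indices.\<close>

definition crossing_bound :: real where
  "crossing_bound = N4 (real m * real n + real p) - N4 p - 4 * real m * real n * N3 p
    - 2 * ((real m * real n)\<^sup>2 * ((real p)\<^sup>2 - 1) / 3)
    - 4 * real p * (real n * N3 m + real n * (real n - 1) * U m)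
    - (real n * N4 m + real n * (real n - 1) * (4 * real m * N3 m + real m * U m)
       + real n * (real n - 1) * (real n - 2) * (2 * real m * U m))"

lemma sum_T_bound:
  "(\<Sum>i\<in>{1..n}. \<Sum>k\<in>{1..n}. T_bound i k) = 2 * (real n * N3 m + real n * (real n - 1) * U m)"
proof -
  have "(\<Sum>i\<in>{1..n}. \<Sum>k\<in>{1..n}. T_bound i k) =
      (\<Sum>i\<in>{1..n}. \<Sum>k\<in>{1..n}. 2 * U m + (if i = k then 2 * N3 m - 2 * U m else 0))"
    by (intro sum.cong refl) (auto simp: T_bound_def)
  also have "\<dots> = 2 * (real n * N3 m + real n * (real n - 1) * U m)"
    by (simp add: sum.distrib algebra_simps)
  finally show ?thesis .
qed

lemma sum_Z_bound:
  "(\<Sum>i\<in>{1..n}. \<Sum>l\<in>{1..n}. \<Sum>k\<in>{1..n}. Z_bound i l k) =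
    real n * N4 m + real n * (real n - 1) * (4 * real m * N3 m + real m * U m)
       + real n * (real n - 1) * (real n - 2) * (2 * real m * U m)"
proof -
  define a b where "a = real m * N3 m" and "b = real m * U m"
  have diag: "(\<Sum>i\<in>{1..n}. \<Sum>l\<in>{1..n}. c + (if i = l then d else 0)) =
      real n * (real n * c) + real n * d" for c d :: real
    by (simp add: sum.distrib distrib_left)
  \<comment> \<open>The case distinction is rewritten through indicators of i = k, l = k and i = l,
    each easy to sum. The innermost coefficient corrects the case i = l = k to
    \<open>N4 m\<close>.\<close>
  have "(\<Sum>i\<in>{1..n}. \<Sum>l\<in>{1..n}. \<Sum>k\<in>{1..n}. Z_bound i l k) =
      (\<Sum>i\<in>{1..n}. \<Sum>l\<in>{1..n}. \<Sum>k\<in>{1..n}. 2 * b + (if i = k then 2 * a - 2 * b else 0)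
        + (if l = k then a - 2 * b else 0)
        + (if i = l then a - b + (if i = k then N4 m - 4 * a + 3 * b else 0) else 0))"
    by (intro sum.cong refl) (auto simp: Z_bound_def a_def b_def)
  also have "\<dots> = (\<Sum>i\<in>{1..n}. \<Sum>l\<in>{1..n}. real n * (2 * b) + (2 * a - 2 * b) + (a - 2 * b)
        + (if i = l then real n * (a - b) + (N4 m - 4 * a + 3 * b) else 0))"
  proof (intro sum.cong refl)
    fix i l assume "i \<in> {1..n}" "l \<in> {1..n}"
    then show "(\<Sum>k\<in>{1..n}. 2 * b + (if i = k then 2 * a - 2 * b else 0)
        + (if l = k then a - 2 * b else 0)
        + (if i = l then a - b + (if i = k then N4 m - 4 * a + 3 * b else 0) else 0)) =
      real n * (2 * b) + (2 * a - 2 * b) + (a - 2 * b)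
        + (if i = l then real n * (a - b) + (N4 m - 4 * a + 3 * b) else 0)"
      by (cases "i = l") (simp_all add: sum.distrib algebra_simps)
  qed
  also have "\<dots> = real n * (real n * (real n * (2 * b) + (2 * a - 2 * b) + (a - 2 * b)))
      + real n * (real n * (a - b) + (N4 m - 4 * a + 3 * b))"
    by (rule diag)
  finally show ?thesis by (simp add: a_def b_def algebra_simps)
qed

lemma T_self: "i \<in> {1..n} \<Longrightarrow> x \<notin> K i \<Longrightarrow> T i x i = 2 * N3 m"
  using nsep_three_one [OF finite_K, of "{x}" i] nsep_flip [of "K i" "K i" "K i" "{x}"] card_K [of i]
  by (simp add: T_def N3_def)

lemma T_le:
  assumes "i \<in> {1..n}" "k \<in> {1..n}" "x \<notin> K i" "x \<notin> K k"
  shows "T i x k \<le> T_bound i k"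
proof (cases "i = k")
  case True
  with assms show ?thesis by (simp add: T_self T_bound_def)
next
  case False
  then have "T i x k \<le> 2 * real m * ((real m)\<^sup>2 - 1) / 3"
    unfolding T_def using assms by (intro nsep_singleton_add_swap_le finite_K disjoint_K card_K)
  with False show ?thesis by (simp add: T_bound_def U_def)
qed

lemma sum_T_eq:
  "nsep (K i) (K i) (K l) (K k) + nsep (K k) (K k) (K l) (K i) = (\<Sum>x\<in>K l. T i x k)"
  unfolding T_def sum.distrib by (simp add: nsep_singletons3 [OF finite_K, symmetric])

lemma nsep_three_parts:
  assumes "i \<in> {1..n}" "k \<in> {1..n}" "i \<noteq> k"
  shows "nsep (K i) (K i) (K i) (K k) = real m * N3 m" "nsep (K i) (K i) (K k) (K i) = real m * N3 m"
proof -
  show "nsep (K i) (K i) (K i) (K k) = real m * N3 m"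
    using nsep_three_one [OF finite_K finite_K, of i k] disjoint_K [of i k] card_K assms
    by (simp add: N3_def)
  then show "nsep (K i) (K i) (K k) (K i) = real m * N3 m"
    by (simp add: nsep_flip)
qed

lemma nsep_four_parts: "i \<in> {1..n} \<Longrightarrow> nsep (K i) (K i) (K i) (K i) = N4 m"
  using nsep_all [OF finite_K, of i] card_K [of i] by (simp add: N4_def)

text \<open>In all cases but two, \<open>Z\<close> does not depend on the positions of the points.\<close>

lemma Z_cases:
  assumes "i \<in> {1..n}" "l \<in> {1..n}" "k \<in> {1..n}"
  shows "i = k \<or> k = l \<Longrightarrow> Z i l k = Z_bound i l k"
    and "i = l \<Longrightarrow> i \<noteq> k \<Longrightarrow> Z i l k = real m * N3 m + nsep (K k) (K k) (K i) (K i)"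
    and "i \<noteq> k \<Longrightarrow> k \<noteq> l \<Longrightarrow> i \<noteq> l \<Longrightarrow> Z i l k = (\<Sum>x\<in>K l. T i x k)"
proof -
  show "Z i l k = Z_bound i l k" if "i = k \<or> k = l"
    using that assms by (auto simp: Z_def Z_bound_def nsep_three_parts nsep_four_parts)
  show "Z i l k = real m * N3 m + nsep (K k) (K k) (K i) (K i)" if "i = l" "i \<noteq> k"
    using that assms by (simp add: Z_def nsep_three_parts)
  show "Z i l k = (\<Sum>x\<in>K l. T i x k)" if "i \<noteq> k" "k \<noteq> l" "i \<noteq> l"
    using that by (simp add: Z_def sum_T_eq)
qed

lemma Z_le:
  assumes "i \<in> {1..n}" "l \<in> {1..n}" "k \<in> {1..n}"
  shows "Z i l k \<le> Z_bound i l k"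
proof -
  consider "i = k \<or> k = l" | "i = l" "i \<noteq> k" | "i \<noteq> k" "k \<noteq> l" "i \<noteq> l" by blast
  then show ?thesis
  proof cases
    case 1
    then show ?thesis using Z_cases(1) [OF assms] by simp
  next
    case 2
    then have "nsep (K k) (K k) (K i) (K i) \<le> (real m)\<^sup>2 * ((real m)\<^sup>2 - 1) / 3"
      using assms m_pos by (intro nsep_two_two_le finite_K card_K disjoint_K) auto
    then show ?thesis
      using Z_cases(2) [OF assms] 2 by (simp add: Z_bound_def U_def power2_eq_square)
  next
    case 3
    have "x \<notin> K i" "x \<notin> K k" if "x \<in> K l" for x
      using disjoint_K [of l i] disjoint_K [of l k] 3 that by auto
    then have "(\<Sum>x\<in>K l. T i x k) \<le> (\<Sum>x\<in>K l. T_bound i k)"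
      using assms by (intro sum_mono T_le) auto
    then show ?thesis
      using Z_cases(3) [OF assms] 3 assms by (simp add: Z_bound_def T_bound_def card_K)
  qed
qed

lemma notin_K0: "x \<in> K 0 \<Longrightarrow> i \<in> {1..n} \<Longrightarrow> x \<notin> K i"
  using disjoint_K [of 0 i] by auto

lemma crossing_bound_eq:
  "crossing_bound = N4 (real m * real n + real p) - N4 p - 4 * real m * real n * N3 p
    - 2 * ((real m * real n)\<^sup>2 * ((real p)\<^sup>2 - 1) / 3)
    - 2 * (\<Sum>x\<in>K 0. \<Sum>i\<in>{1..n}. \<Sum>k\<in>{1..n}. T_bound i k)
    - (\<Sum>i\<in>{1..n}. \<Sum>l\<in>{1..n}. \<Sum>k\<in>{1..n}. Z_bound i l k)"
  unfolding sum_T_bound sum_Z_bound crossing_bound_def by (simp add: card_K0)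

lemma crossing_bound_le: "crossing_bound \<le> crossing_sum n K"
proof -
  have "nsep (K 0) (K 0) S S \<le> (real (m * n))\<^sup>2 * ((real p)\<^sup>2 - 1) / 3"
    using p_pos by (intro nsep_two_two_le finite_K finite_S card_S card_K0 K0_S)
  moreover have "(\<Sum>x\<in>K 0. \<Sum>i\<in>{1..n}. \<Sum>k\<in>{1..n}. T i x k) \<le>
      (\<Sum>x\<in>K 0. \<Sum>i\<in>{1..n}. \<Sum>k\<in>{1..n}. T_bound i k)"
    by (intro sum_mono T_le notin_K0)
  moreover have "(\<Sum>i\<in>{1..n}. \<Sum>l\<in>{1..n}. \<Sum>k\<in>{1..n}. Z i l k) \<le>
      (\<Sum>i\<in>{1..n}. \<Sum>l\<in>{1..n}. \<Sum>k\<in>{1..n}. Z_bound i l k)"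
    by (intro sum_mono Z_le)
  ultimately show ?thesis
    unfolding crossing_bound_eq crossing_sum_decomposition by simp
qed

text \<open>\<open>lin\<close> spreads \<open>S\<close> evenly over the gaps of \<open>P\<close>.
  The other hypotheses say that two parts i < k alternate along the line, i first, which makes every
  \<open>T\<close> and every \<open>kkii\<close> extremal.\<close>

lemma crossing_sum_eq_bound:
  assumes lin: "\<And>x. x \<in> K 0 \<Longrightarrow> real (below S x) = real (below (K 0) x) * real (m * n) / real p"
    and alt: "\<And>i k x. 1 \<le> i \<Longrightarrow> i < k \<Longrightarrow> k \<le> n \<Longrightarrow>
        below (K i) x = below (K k) x \<or> below (K i) x = below (K k) x + 1"
    and alt_left: "\<And>i k x. 1 \<le> i \<Longrightarrow> i < k \<Longrightarrow> k \<le> n \<Longrightarrow> x \<in> K i \<Longrightarrow> below (K i) x = below (K k) x"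
    and alt_right: "\<And>i k x. 1 \<le> i \<Longrightarrow> i < k \<Longrightarrow> k \<le> n \<Longrightarrow> x \<in> K k \<Longrightarrow> below (K i) x = below (K k) x + 1"
  shows "crossing_sum n K = crossing_bound"
proof -
  have T_less: "T i x k = T_bound i k"
    if "i \<in> {1..n}" "k \<in> {1..n}" "x \<notin> K i" "x \<notin> K k" "i < k" for i x k
  proof -
    have "T i x k = 2 * real m * ((real m)\<^sup>2 - 1) / 3"
      unfolding T_def using that
      by (intro nsep_singleton_add_swap_eq finite_K disjoint_K card_K alt alt_right) auto
    then show ?thesis using that by (simp add: T_bound_def U_def)
  qed
  have T_eq: "T i x k = T_bound i k"
    if "i \<in> {1..n}" "k \<in> {1..n}" "x \<notin> K i" "x \<notin> K k" for i x k
  proof (cases i k rule: linorder_cases)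
    case less
    with that show ?thesis by (intro T_less)
  next
    case equal
    with that show ?thesis by (simp add: T_self T_bound_def)
  next
    case greater
    have "T i x k = T k x i" by (simp add: T_def)
    also have "\<dots> = T_bound k i" using that greater by (intro T_less)
    finally show ?thesis using greater by (simp add: T_bound_def)
  qed
  have Z_eq: "Z i l k = Z_bound i l k" if ilk: "i \<in> {1..n}" "l \<in> {1..n}" "k \<in> {1..n}" for i l k
  proof -
    consider "i = k \<or> k = l" | "i = l" "i \<noteq> k" | "i \<noteq> k" "k \<noteq> l" "i \<noteq> l" by blast
    then show ?thesis
    proof cases
      case 1
      then show ?thesis using Z_cases(1) [OF ilk] by simp
    next
      case 2
      have "nsep (K k) (K k) (K i) (K i) = (real m)\<^sup>2 * ((real m)\<^sup>2 - 1) / 3"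
      \<comment> \<open>Seen from a point of part k, part i is one ahead if it comes first and level
        otherwise; the slope is m / m.\<close>
      proof (rule nsep_two_two_eq [where k = "if i < k then 1 else 0"])
        show "K k \<inter> K i = {}" using 2 by (intro disjoint_K) auto
        show "real (below (K i) x) = (if i < k then 1 else 0) + real (below (K k) x) * real m / real m"
          if "x \<in> K k" for x
          using that 2 ilk m_pos alt_left [of k i x] alt_right [of i k x] by auto
      qed (use ilk m_pos in \<open>auto simp: finite_K card_K\<close>)
      then show ?thesis
        using Z_cases(2) [OF ilk] 2 by (simp add: Z_bound_def U_def power2_eq_square)
    next
      case 3
      have "x \<notin> K i" "x \<notin> K k" if "x \<in> K l" for x
        using disjoint_K [of l i] disjoint_K [of l k] 3 that by auto
      then have "(\<Sum>x\<in>K l. T i x k) = (\<Sum>x\<in>K l. T_bound i k)"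
        using ilk by (intro sum.cong refl T_eq) auto
      then show ?thesis
        using Z_cases(3) [OF ilk] 3 ilk by (simp add: Z_bound_def T_bound_def card_K)
    qed
  qed
  have "nsep (K 0) (K 0) S S = (real (m * n))\<^sup>2 * ((real p)\<^sup>2 - 1) / 3"
    using p_pos lin by (intro nsep_two_two_eq [where k = 0] finite_K finite_S card_S card_K0 K0_S) auto
  moreover have "(\<Sum>x\<in>K 0. \<Sum>i\<in>{1..n}. \<Sum>k\<in>{1..n}. T i x k) =
      (\<Sum>x\<in>K 0. \<Sum>i\<in>{1..n}. \<Sum>k\<in>{1..n}. T_bound i k)"
    by (intro sum.cong refl T_eq notin_K0)
  moreover have "(\<Sum>i\<in>{1..n}. \<Sum>l\<in>{1..n}. \<Sum>k\<in>{1..n}. Z i l k) =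
      (\<Sum>i\<in>{1..n}. \<Sum>l\<in>{1..n}. \<Sum>k\<in>{1..n}. Z_bound i l k)"
    by (intro sum.cong refl Z_eq)
  ultimately show ?thesis
    unfolding crossing_bound_eq crossing_sum_decomposition by (simp only: of_nat_mult)
qed

lemma crossing_bound_polynomial:
  "crossing_bound = 8 * (
      1/24 * real m ^ 4 * real n ^ 4 + 1/12 * real m ^ 2 * real n ^ 3
    - 1/12 * real m ^ 4 * real n ^ 3 - 1/4 * real m ^ 3 * real n ^ 3
    + 1/2 * real m ^ 3 * real n ^ 2 + 1/24 * real m ^ 4 * real n ^ 2
    - 1/4 * real m ^ 3 * real n
    + 1/6 * real m ^ 2 * real n ^ 2 * real p ^ 2 - 1/4 * real p ^ 2 * real m * real n
    - 3/4 * real m ^ 2 * real n ^ 2 * real p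
    + 1/12 * real m * real n * real p + 1/2 * real m ^ 2 * real n * real p
    - 1/6 * real m ^ 3 * real n ^ 2 * real p
    + 1/6 * real m ^ 3 * real n ^ 3 * real p
    + 1/6 * real m * real n ^ 2 * real p)"
  unfolding crossing_bound_def N3_def N4_def U_def
  by (simp add: power2_eq_square power3_eq_cube power4_eq_xxxx algebra_simps add_divide_distrib diff_divide_distrib)

end

section \<open>Chords of a circle\<close>

text \<open>Twice the signed area of the triangle a, b, z; positive iff z lies to the left of the
  line from a to b.\<close>

definition side :: "complex \<Rightarrow> complex \<Rightarrow> complex \<Rightarrow> real" where
  "side a b z = Im ((z - a) * cnj (b - a))"

lemma side_convex:
  "side a b ((1 - t) *\<^sub>R z + t *\<^sub>R w) = (1 - t) * side a b z + t * side a b w"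
  by (simp add: side_def algebra_simps)

lemma side_on_line: "z \<in> open_segment a b \<Longrightarrow> side a b z = 0"
  using side_convex [of a b _ a b] by (auto simp: in_segment) (simp add: side_def algebra_simps)

lemma cis_diff: "cis \<alpha> - cis \<beta> = 2 * \<i> * of_real (sin ((\<alpha> - \<beta>) / 2)) * cis ((\<alpha> + \<beta>) / 2)"
proof (rule complex_eqI)
  have "sin ((\<beta> - \<alpha>) / 2) = - sin ((\<alpha> - \<beta>) / 2)"
    by (metis minus_diff_eq minus_divide_left sin_minus)
  then show "Re (cis \<alpha> - cis \<beta>) = Re (2 * \<i> * of_real (sin ((\<alpha> - \<beta>) / 2)) * cis ((\<alpha> + \<beta>) / 2))"
    by (simp add: cos_diff_cos)
qed (simp add: sin_diff_sin)

text \<open>By \<open>cis_diff\<close> each difference is a sine of a half angle times a phase. The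
  phases combine to \<open>cis ((\<gamma> - \<beta>) / 2)\<close>, whose imaginary part is the third
  sine.\<close>

lemma side_circle:
  "side (c + of_real r * cis \<alpha>) (c + of_real r * cis \<beta>) (c + of_real r * cis \<gamma>) =
    4 * r\<^sup>2 * sin ((\<gamma> - \<alpha>) / 2) * sin ((\<beta> - \<alpha>) / 2) * sin ((\<gamma> - \<beta>) / 2)"
proof -
  have "(c + of_real r * cis \<gamma> - (c + of_real r * cis \<alpha>)) *
      cnj (c + of_real r * cis \<beta> - (c + of_real r * cis \<alpha>)) =
      of_real (r\<^sup>2) * ((cis \<gamma> - cis \<alpha>) * cnj (cis \<beta> - cis \<alpha>))"
    by (simp add: algebra_simps power2_eq_square)
  also have "(cis \<gamma> - cis \<alpha>) * cnj (cis \<beta> - cis \<alpha>) =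
      of_real (4 * sin ((\<gamma> - \<alpha>) / 2) * sin ((\<beta> - \<alpha>) / 2)) * (cis ((\<gamma> + \<alpha>) / 2) * cis (- ((\<beta> + \<alpha>) / 2)))"
  proof -
    have conj: "cnj (2 * \<i> * of_real x * cis u) = - 2 * \<i> * of_real x * cis (- u)" for x u
      by (simp add: cis_cnj)
    have "\<i> * \<i> = -1" by simp
    then have mult: "(2 * \<i> * x * y) * (- 2 * \<i> * x' * y') = 4 * x * x' * (y * y')" for x y x' y' :: complex
      by algebra
    show ?thesis unfolding cis_diff conj mult by simp
  qed
  also have "cis ((\<gamma> + \<alpha>) / 2) * cis (- ((\<beta> + \<alpha>) / 2)) = cis ((\<gamma> - \<beta>) / 2)"
    unfolding cis_mult by (rule arg_cong [where f = cis]) (simp add: field_simps)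
  finally show ?thesis
    by (simp add: side_def del: of_real_mult)
qed

text \<open>Angles in one period differ by less than 2 pi, so the half angle stays within (-pi, pi);
  geometry thus reduces to the order of the angles.\<close>

lemma sgn_sin_half:
  assumes "\<bar>x\<bar> < 2 * pi"
  shows "sgn (sin (x / 2)) = sgn x"
proof (cases x "0::real" rule: linorder_cases)
  case less
  then have "sin (- (x / 2)) > 0" using assms by (intro sin_gt_zero) auto
  then show ?thesis using less by simp
next
  case greater
  then have "sin (x / 2) > 0" using assms by (intro sin_gt_zero) auto
  then show ?thesis using greater by simp
qed simp

lemma norm_convex_combination:
  fixes x y :: complex
  shows "(norm ((1 - t) *\<^sub>R x + t *\<^sub>R y))\<^sup>2 = (1 - t) * (norm x)\<^sup>2 + t * (norm y)\<^sup>2 - t * (1 - t) * (norm (x - y))\<^sup>2"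
  unfolding cmod_power2 by simp algebra

locale circle_points =
  fixes c :: complex and r :: real and pt :: "real \<Rightarrow> complex"
  assumes r_pos: "r > 0"
    and pt_def: "pt = (\<lambda>\<alpha>. c + of_real r * cis \<alpha>)"
begin

text \<open>Both factors contain the sine of (\<beta> - \<alpha>) / 2, which enters squared; the
  four remaining sines have the signs of the differences in \<open>sep\<close>.\<close>

lemma sgn_side_mult:
  assumes "\<alpha> \<noteq> \<beta>" "\<bar>\<beta> - \<alpha>\<bar> < 2 * pi" "\<bar>\<gamma> - \<alpha>\<bar> < 2 * pi" "\<bar>\<gamma> - \<beta>\<bar> < 2 * pi"
    "\<bar>\<delta> - \<alpha>\<bar> < 2 * pi" "\<bar>\<delta> - \<beta>\<bar> < 2 * pi"
  shows "sgn (side (pt \<alpha>) (pt \<beta>) (pt \<gamma>) * side (pt \<alpha>) (pt \<beta>) (pt \<delta>)) =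
    sgn ((\<alpha> - \<gamma>) * (\<alpha> - \<delta>) * (\<beta> - \<gamma>) * (\<beta> - \<delta>))"
proof -
  have "sgn (\<beta> - \<alpha>) = 1 \<or> sgn (\<beta> - \<alpha>) = - 1" using assms(1) by (auto simp: sgn_if)
  then have "sgn (side (pt \<alpha>) (pt \<beta>) (pt \<gamma>) * side (pt \<alpha>) (pt \<beta>) (pt \<delta>)) =
      sgn (\<gamma> - \<alpha>) * sgn (\<gamma> - \<beta>) * sgn (\<delta> - \<alpha>) * sgn (\<delta> - \<beta>)"
    unfolding pt_def side_circle using r_pos
    by (elim disjE) (simp_all only: sgn_mult sgn_sin_half assms, simp_all)
  also have "\<dots> = sgn ((\<gamma> - \<alpha>) * (\<gamma> - \<beta>) * (\<delta> - \<alpha>) * (\<delta> - \<beta>))"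
    by (simp add: sgn_mult)
  also have "(\<gamma> - \<alpha>) * (\<gamma> - \<beta>) * (\<delta> - \<alpha>) * (\<delta> - \<beta>) = (\<alpha> - \<gamma>) * (\<alpha> - \<delta>) * (\<beta> - \<gamma>) * (\<beta> - \<delta>)"
    by algebra
  finally show ?thesis .
qed

lemma side_eq_0:
  assumes "\<alpha> \<noteq> \<beta>" "\<bar>\<beta> - \<alpha>\<bar> < 2 * pi" "\<bar>\<gamma> - \<alpha>\<bar> < 2 * pi" "\<bar>\<gamma> - \<beta>\<bar> < 2 * pi"
    "side (pt \<alpha>) (pt \<beta>) (pt \<gamma>) = 0"
  shows "\<gamma> = \<alpha> \<or> \<gamma> = \<beta>"
proof -
  have *: "sin (x / 2) \<noteq> 0" if "x \<noteq> 0" "\<bar>x\<bar> < 2 * pi" for x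
    using sgn_sin_half [OF that(2)] that(1) by (metis sgn_0_0)
  show ?thesis
    using assms(5) r_pos * [of "\<beta> - \<alpha>"] * [of "\<gamma> - \<alpha>"] * [of "\<gamma> - \<beta>"] assms(1-4)
    unfolding pt_def side_circle by auto
qed

lemma pt_neq:
  assumes "\<alpha> \<noteq> \<beta>" "\<bar>\<beta> - \<alpha>\<bar> < 2 * pi"
  shows "pt \<alpha> \<noteq> pt \<beta>"
proof
  assume "pt \<alpha> = pt \<beta>"
  then have "cis \<beta> - cis \<alpha> = 0" using r_pos by (simp add: pt_def)
  then have "sin ((\<beta> - \<alpha>) / 2) = 0" unfolding cis_diff by simp
  then show False using sgn_sin_half [OF assms(2)] assms(1) by (simp add: sgn_0_0)
qed

text \<open>The power of a point: for distinct endpoints, a point of the line lies inside the circle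
  iff \<open>t * (1 - t) > 0\<close>.\<close>

lemma norm_chord:
  "(norm ((1 - t) *\<^sub>R pt \<alpha> + t *\<^sub>R pt \<beta> - c))\<^sup>2 = r\<^sup>2 - t * (1 - t) * (norm (pt \<alpha> - pt \<beta>))\<^sup>2"
proof -
  have e: "(1 - t) *\<^sub>R pt \<alpha> + t *\<^sub>R pt \<beta> - c = (1 - t) *\<^sub>R (pt \<alpha> - c) + t *\<^sub>R (pt \<beta> - c)"
    by (simp add: algebra_simps)
  have n: "norm (pt x - c) = r" for x using r_pos by (simp add: pt_def norm_mult)
  show ?thesis
    unfolding e norm_convex_combination n by (simp add: algebra_simps)
qed

text \<open>A line meets the circle in at most two points.\<close>

lemma not_both_on_line:
  assumes "\<alpha> \<noteq> \<beta>" "\<gamma> \<noteq> \<delta>" "{\<alpha>, \<beta>} \<noteq> {\<gamma>, \<delta>}"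
    and near: "\<And>x y. x \<in> {\<alpha>, \<beta>, \<gamma>, \<delta>} \<Longrightarrow> y \<in> {\<alpha>, \<beta>, \<gamma>, \<delta>} \<Longrightarrow> \<bar>x - y\<bar> < 2 * pi"
  shows "side (pt \<alpha>) (pt \<beta>) (pt \<gamma>) \<noteq> 0 \<or> side (pt \<alpha>) (pt \<beta>) (pt \<delta>) \<noteq> 0"
proof (rule ccontr)
  assume "\<not> ?thesis"
  then have "\<gamma> = \<alpha> \<or> \<gamma> = \<beta>" "\<delta> = \<alpha> \<or> \<delta> = \<beta>"
    using side_eq_0 [of \<alpha> \<beta> \<gamma>] side_eq_0 [of \<alpha> \<beta> \<delta>] near [of \<beta> \<alpha>] near [of \<gamma> \<alpha>] near [of \<gamma> \<beta>]
      near [of \<delta> \<alpha>] near [of \<delta> \<beta>] assms(1) by auto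
  then show False using assms(2,3) by auto
qed

text \<open>By \<open>sgn_side_mult\<close>, \<open>sep\<close> says that \<gamma> and \<delta> lie
  on opposite sides of the line through \<alpha> and \<beta>. A common point forces this, as
  \<open>side\<close> is affine along the second chord. Chords with one common endpoint are
  included; both statements are then false.\<close>

lemma chords_intersect_iff:
  assumes "\<alpha> \<noteq> \<beta>" "\<gamma> \<noteq> \<delta>" "{\<alpha>, \<beta>} \<noteq> {\<gamma>, \<delta>}"
    and near: "\<And>x y. x \<in> {\<alpha>, \<beta>, \<gamma>, \<delta>} \<Longrightarrow> y \<in> {\<alpha>, \<beta>, \<gamma>, \<delta>} \<Longrightarrow> \<bar>x - y\<bar> < 2 * pi"
  shows "open_segment (pt \<alpha>) (pt \<beta>) \<inter> open_segment (pt \<gamma>) (pt \<delta>) \<noteq> {} \<longleftrightarrow> sep \<alpha> \<beta> \<gamma> \<delta>"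
proof -
  let ?C = "side (pt \<alpha>) (pt \<beta>) (pt \<gamma>)" and ?D = "side (pt \<alpha>) (pt \<beta>) (pt \<delta>)"
  have "sgn (?C * ?D) = sgn ((\<alpha> - \<gamma>) * (\<alpha> - \<delta>) * (\<beta> - \<gamma>) * (\<beta> - \<delta>))"
    using assms(1) near by (intro sgn_side_mult) auto
  then have sep: "sep \<alpha> \<beta> \<gamma> \<delta> \<longleftrightarrow> ?C * ?D < 0"
    unfolding sep_def by (metis sgn_less)
  show ?thesis
  proof
    assume "open_segment (pt \<alpha>) (pt \<beta>) \<inter> open_segment (pt \<gamma>) (pt \<delta>) \<noteq> {}"
    then obtain z where z: "z \<in> open_segment (pt \<alpha>) (pt \<beta>)" "z \<in> open_segment (pt \<gamma>) (pt \<delta>)" by auto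
    then obtain t where t: "0 < t" "t < 1" "z = (1 - t) *\<^sub>R pt \<gamma> + t *\<^sub>R pt \<delta>"
      by (auto simp: in_segment)
    have "(1 - t) * ?C + t * ?D = 0"
      using side_on_line [OF z(1)] t(3) side_convex by simp
    then have D: "?D = - ((1 - t) / t) * ?C" using t by (simp add: field_simps)
    have "?C \<noteq> 0" using not_both_on_line [OF assms] D by auto
    then have "?C * ?C > 0" by (metis not_real_square_gt_zero)
    moreover have "?C * ?D = - ((1 - t) / t) * (?C * ?C)" by (subst D) simp
    ultimately show "sep \<alpha> \<beta> \<gamma> \<delta>"
      unfolding sep using t by (auto intro!: mult_neg_pos divide_pos_pos)
  next
    assume "sep \<alpha> \<beta> \<gamma> \<delta>"
    then have CD: "?C * ?D < 0" using sep by simp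
    \<comment> \<open>The parameter at which the affine function \<open>side\<close> vanishes on the
      second chord.\<close>
    define t where "t = ?C / (?C - ?D)"
    have t: "0 < t" "t < 1" "(1 - t) * ?C + t * ?D = 0"
    proof -
      have ne: "?C - ?D \<noteq> 0" using CD by auto
      consider "?C > 0" "?D < 0" | "?C < 0" "?D > 0" using CD by (auto simp: mult_less_0_iff)
      then show "0 < t" "t < 1"
        unfolding t_def by (cases; auto simp: divide_less_eq zero_less_divide_iff)+
      show "(1 - t) * ?C + t * ?D = 0" unfolding t_def using ne by (simp add: field_simps)
    qed
    define z where "z = (1 - t) *\<^sub>R pt \<gamma> + t *\<^sub>R pt \<delta>"
    have ne: "pt \<alpha> \<noteq> pt \<beta>" "pt \<gamma> \<noteq> pt \<delta>" 
      using assms(1,2) pt_neq [of \<alpha> \<beta>] pt_neq [of \<gamma> \<delta>] near [of \<beta> \<alpha>] near [of \<delta> \<gamma>] by auto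
    have z2: "z \<in> open_segment (pt \<gamma>) (pt \<delta>)" using t ne by (auto simp: in_segment z_def)
    have "side (pt \<alpha>) (pt \<beta>) z = 0" using t(3) by (simp add: z_def side_convex)
    define q where "q = (z - pt \<alpha>) / (pt \<beta> - pt \<alpha>)"
    have "Im q = 0"
      using \<open>side (pt \<alpha>) (pt \<beta>) z = 0\<close> unfolding q_def side_def
      by (simp add: complex_div_cnj [of "z - pt \<alpha>"])
    then have q: "q = of_real (Re q)" by (simp add: complex_eq_iff)
    define s where "s = Re q"
    have "z = pt \<alpha> + of_real s * (pt \<beta> - pt \<alpha>)"
      using ne q unfolding s_def q_def by (simp add: field_simps)
    then have zs: "z = (1 - s) *\<^sub>R pt \<alpha> + s *\<^sub>R pt \<beta>"
      by (simp add: algebra_simps scaleR_conv_of_real)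
    \<comment> \<open>So far z lies only on the line through the first chord. Being interior to the
      second chord, it is inside the circle, and comparing its power along both lines gives 0 < s <
      1.\<close>
    have "r\<^sup>2 - s * (1 - s) * (norm (pt \<alpha> - pt \<beta>))\<^sup>2 = r\<^sup>2 - t * (1 - t) * (norm (pt \<gamma> - pt \<delta>))\<^sup>2"
      using norm_chord [of s \<alpha> \<beta>] norm_chord [of t \<gamma> \<delta>] zs z_def by simp
    moreover have "t * (1 - t) * (norm (pt \<gamma> - pt \<delta>))\<^sup>2 > 0" using t ne by simp
    ultimately have "s * (1 - s) * (norm (pt \<alpha> - pt \<beta>))\<^sup>2 > 0" by linarith
    then have "s * (1 - s) > 0" by (simp add: zero_less_mult_iff)
    then have "0 < s" "s < 1" by (auto simp: zero_less_mult_iff)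
    then have "z \<in> open_segment (pt \<alpha>) (pt \<beta>)" using zs ne by (auto simp: in_segment)
    with z2 show "open_segment (pt \<alpha>) (pt \<beta>) \<inter> open_segment (pt \<gamma>) (pt \<delta>) \<noteq> {}" by auto
  qed
qed

text \<open>Along the second chord \<open>side\<close> is affine and not constant, otherwise it
  would vanish at both endpoints; so it has one zero.\<close>

lemma chords_intersect_unique:
  assumes "\<alpha> \<noteq> \<beta>" "\<gamma> \<noteq> \<delta>" "{\<alpha>, \<beta>} \<noteq> {\<gamma>, \<delta>}"
    and near: "\<And>x y. x \<in> {\<alpha>, \<beta>, \<gamma>, \<delta>} \<Longrightarrow> y \<in> {\<alpha>, \<beta>, \<gamma>, \<delta>} \<Longrightarrow> \<bar>x - y\<bar> < 2 * pi"
    and z: "z \<in> open_segment (pt \<alpha>) (pt \<beta>)" "z \<in> open_segment (pt \<gamma>) (pt \<delta>)"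
    and w: "w \<in> open_segment (pt \<alpha>) (pt \<beta>)" "w \<in> open_segment (pt \<gamma>) (pt \<delta>)"
  shows "z = w"
proof -
  let ?C = "side (pt \<alpha>) (pt \<beta>) (pt \<gamma>)" and ?D = "side (pt \<alpha>) (pt \<beta>) (pt \<delta>)"
  obtain t where t: "0 < t" "t < 1" "z = (1 - t) *\<^sub>R pt \<gamma> + t *\<^sub>R pt \<delta>"
    using z(2) by (auto simp: in_segment)
  obtain u where u: "0 < u" "u < 1" "w = (1 - u) *\<^sub>R pt \<gamma> + u *\<^sub>R pt \<delta>"
    using w(2) by (auto simp: in_segment)
  have 1: "(1 - t) * ?C + t * ?D = 0" using side_on_line [OF z(1)] t(3) side_convex by simp
  have 2: "(1 - u) * ?C + u * ?D = 0" using side_on_line [OF w(1)] u(3) side_convex by simp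
  have "(t - u) * (?D - ?C) = 0" using 1 2 by (simp add: algebra_simps)
  moreover have "?D \<noteq> ?C"
  proof
    assume "?D = ?C"
    then have "?C = 0" using 1 by (simp add: algebra_simps)
    then show False using not_both_on_line [OF assms(1-3) near] \<open>?D = ?C\<close> by simp
  qed
  ultimately show ?thesis using t(3) u(3) by simp
qed
end

lemma open_edge_doubleton: "open_edge f {u, v} = open_segment (f u) (f v)"
  unfolding open_edge_def by (auto simp: doubleton_eq_iff open_segment_commute)

section \<open>Points in general position on the upper half circle\<close>

interpretation unit_circle: circle_points 0 1 cis
  by unfold_locales auto

lemma near_if_upper_half:
  assumes "A \<subseteq> {0<..<pi}" "x \<in> A" "y \<in> A"
  shows "\<bar>x - y\<bar> < 2 * pi"
proof -
  have "0 < x" "x < pi" "0 < y" "y < pi" using assms by auto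
  then show ?thesis by linarith
qed

text \<open>The edges of the complete graph: general position for all chords serves every graph on
  these points.\<close>

definition index_pairs :: "nat \<Rightarrow> nat set set" where
  "index_pairs N = {{a, b} | a b. a < N \<and> b < N \<and> a \<noteq> b}"

lemma finite_index_pairs: "finite (index_pairs N)"
  by (rule finite_subset [of _ "Pow {..<N}"]) (auto simp: index_pairs_def)

lemma index_pairs_Suc:
  assumes "e \<in> index_pairs (Suc N)"
  shows "N \<notin> e \<Longrightarrow> e \<in> index_pairs N" "N \<in> e \<Longrightarrow> \<exists>i<N. e = {i, N}"
proof -
  obtain a b where e: "e = {a, b}" "a < Suc N" "b < Suc N" "a \<noteq> b"
    using assms by (auto simp: index_pairs_def)
  show "e \<in> index_pairs N" if "N \<notin> e"
  proof -
    have "a < N" "b < N" using e that by auto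
    then show ?thesis using e unfolding index_pairs_def by blast
  qed
  show "\<exists>i<N. e = {i, N}" if "N \<in> e"
  proof (cases "a = N")
    case True
    then have "b < N" "e = {b, N}" using e by auto
    then show ?thesis by blast
  next
    case False
    then have "a < N" "e = {a, N}" using e that by auto
    then show ?thesis by blast
  qed
qed

text \<open>The points are placed one after another: a chord from an old point through an intersection
  of two old chords excludes just one position of the new point.\<close>

lemma generic_angles_exist:
  "\<exists>t::nat \<Rightarrow> real. (\<forall>i j. i < j \<and> j < N \<longrightarrow> t i < t j) \<and> (\<forall>i<N. 0 < t i \<and> t i < pi) \<and>
     (\<forall>e1\<in>index_pairs N. \<forall>e2\<in>index_pairs N. \<forall>e3\<in>index_pairs N.
        e1 \<noteq> e2 \<and> e1 \<noteq> e3 \<and> e2 \<noteq> e3 \<longrightarrow>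
        open_edge (\<lambda>i. cis (t i)) e1 \<inter> open_edge (\<lambda>i. cis (t i)) e2 \<inter> open_edge (\<lambda>i. cis (t i)) e3 = {})"
proof (induction N)
  case 0
  show ?case by (auto simp: index_pairs_def)
next
  case (Suc N)
  then obtain t where incr: "\<And>i j. i < j \<Longrightarrow> j < N \<Longrightarrow> t i < t j"
    and range: "\<And>i. i < N \<Longrightarrow> 0 < t i \<and> t i < pi"
    and gen: "\<And>e1 e2 e3. e1 \<in> index_pairs N \<Longrightarrow> e2 \<in> index_pairs N \<Longrightarrow> e3 \<in> index_pairs N \<Longrightarrow>
        e1 \<noteq> e2 \<Longrightarrow> e1 \<noteq> e3 \<Longrightarrow> e2 \<noteq> e3 \<Longrightarrow>
        open_edge (\<lambda>i. cis (t i)) e1 \<inter> open_edge (\<lambda>i. cis (t i)) e2 \<inter> open_edge (\<lambda>i. cis (t i)) e3 = {}"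
    by metis
  let ?E = "open_edge (\<lambda>i. cis (t i))"
  have t_inj: "t i = t j \<longleftrightarrow> i = j" if "i < N" "j < N" for i j
    using incr [of i j] incr [of j i] that by (cases i j rule: linorder_cases) auto
  \<comment> \<open>The new angle is chosen in (L, pi), beyond all old ones, which keeps the
    sequence increasing.\<close>
  obtain L where L: "0 \<le> L" "L < pi" "\<And>i. i < N \<Longrightarrow> t i \<le> L"
  proof (cases N)
    case 0
    then show ?thesis using that [of 0] by simp
  next
    case (Suc M)
    have "t i \<le> t M" if "i < N" for i
      using incr [of i M] that Suc by (cases "i = M") (auto simp: less_Suc_eq)
    then show ?thesis using that [of "t M"] range [of M] Suc by auto
  qed
  define bad where "bad i e2 e3 = {x. L < x \<and> x < pi \<and> open_segment (cis (t i)) (cis x) \<inter> ?E e2 \<inter> ?E e3 \<noteq> {}}"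
    for i e2 e3
  have bad_unique: "x = y"
    if i: "i < N" and e: "e2 \<in> index_pairs N" "e3 \<in> index_pairs N" "e2 \<noteq> e3"
      and xy: "x \<in> bad i e2 e3" "y \<in> bad i e2 e3" for i e2 e3 x y
  proof (rule ccontr)
    assume "x \<noteq> y"
    obtain a b where ab: "e2 = {a, b}" "a < N" "b < N" "a \<noteq> b"
      using e(1) by (auto simp: index_pairs_def)
    obtain c d where cd: "e3 = {c, d}" "c < N" "d < N" "c \<noteq> d"
      using e(2) by (auto simp: index_pairs_def)
    obtain z where z: "z \<in> open_segment (cis (t i)) (cis x)" "z \<in> ?E e2" "z \<in> ?E e3"
      using xy(1) by (auto simp: bad_def)
    obtain w where w: "w \<in> open_segment (cis (t i)) (cis y)" "w \<in> ?E e2" "w \<in> ?E e3"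
      using xy(2) by (auto simp: bad_def)
    \<comment> \<open>Both points are the unique intersection of the old chords e2 and e3.\<close>
    have "z = w"
    proof (rule unit_circle.chords_intersect_unique [of "t a" "t b" "t c" "t d"])
      show "{t a, t b} \<noteq> {t c, t d}"
        using e(3) ab cd by (auto simp: doubleton_eq_iff t_inj)
      show "\<bar>u - v\<bar> < 2 * pi" if "u \<in> {t a, t b, t c, t d}" "v \<in> {t a, t b, t c, t d}" for u v
        using range ab cd by (intro near_if_upper_half [OF _ that]) auto
    qed (use z w ab cd in \<open>auto simp: open_edge_doubleton t_inj\<close>)
    then have ne: "open_segment (cis (t i)) (cis x) \<inter> open_segment (cis (t i)) (cis y) \<noteq> {}"
      using z(1) w(1) by auto
    have x: "t i < x" "x < pi" "t i < y" "y < pi"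
      using xy L(3) [OF i] by (auto simp: bad_def)
    \<comment> \<open>Two chords from the same point with different ends would meet again; but
      \<open>sep\<close> fails at a shared endpoint.\<close>
    have "sep (t i) x (t i) y"
    proof (subst unit_circle.chords_intersect_iff [symmetric])
      show "\<bar>u - v\<bar> < 2 * pi" if "u \<in> {t i, x, t i, y}" "v \<in> {t i, x, t i, y}" for u v
        using range [OF i] x by (intro near_if_upper_half [OF _ that]) auto
    qed (use ne x \<open>x \<noteq> y\<close> in \<open>auto simp: doubleton_eq_iff\<close>)
    then show False by (simp add: sep_def)
  qed
  define Bad where "Bad = (\<Union>i<N. \<Union>e2\<in>index_pairs N. \<Union>e3\<in>index_pairs N - {e2}. bad i e2 e3)"
  have "finite (bad i e2 e3)"
    if "i < N" "e2 \<in> index_pairs N" "e3 \<in> index_pairs N - {e2}" for i e2 e3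
  proof (cases "bad i e2 e3 = {}")
    case False
    then obtain x where "x \<in> bad i e2 e3" by auto
    then have "bad i e2 e3 \<subseteq> {x}" using bad_unique that by blast
    then show ?thesis by (rule finite_subset) simp
  qed simp
  then have "finite Bad"
    unfolding Bad_def using finite_index_pairs by auto
  then have "infinite ({L<..<pi} - Bad)"
    using L by (intro Diff_infinite_finite infinite_Ioo)
  then obtain x where x: "L < x" "x < pi" "x \<notin> Bad"
    by (metis DiffD1 DiffD2 finite.emptyI ex_in_conv greaterThanLessThan_iff)
  define t' where "t' = t(N := x)"
  let ?E' = "open_edge (\<lambda>i. cis (t' i))"
  have old: "?E' e = ?E e" if "e \<in> index_pairs N" for e
    using that by (auto simp: index_pairs_def open_edge_doubleton t'_def)
  have new: "?E' {i, N} = open_segment (cis (t i)) (cis x)" if "i < N" for i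
    using that by (simp add: open_edge_doubleton t'_def)
  have one: "?E' e1 \<inter> ?E' e2 \<inter> ?E' e3 = {}"
    if e: "e1 \<in> index_pairs (Suc N)" "N \<in> e1" "e2 \<in> index_pairs N" "e3 \<in> index_pairs N" "e2 \<noteq> e3" for e1 e2 e3
  proof -
    obtain i where i: "i < N" "e1 = {i, N}" using index_pairs_Suc(2) e by blast
    have "x \<notin> bad i e2 e3" using x(3) i e by (auto simp: Bad_def)
    then show ?thesis using x i e by (simp add: old new bad_def)
  qed
  \<comment> \<open>Two new chords share the new point and so meet nowhere else; only triples with
    at most one new chord need genericity.\<close>
  have two: "?E' e1 \<inter> ?E' e2 = {}"
    if e: "e1 \<in> index_pairs (Suc N)" "e2 \<in> index_pairs (Suc N)" "N \<in> e1" "N \<in> e2" "e1 \<noteq> e2" for e1 e2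
  proof (rule ccontr)
    assume ne: "?E' e1 \<inter> ?E' e2 \<noteq> {}"
    obtain i where i: "i < N" "e1 = {i, N}" using index_pairs_Suc(2) e by blast
    obtain j where j: "j < N" "e2 = {j, N}" using index_pairs_Suc(2) e by blast
    have ij: "t i \<noteq> t j" "t i < x" "t j < x"
      using i j e(5) t_inj [of i j] L(3) [of i] L(3) [of j] x by auto
    have "sep (t i) x (t j) x"
    proof (subst unit_circle.chords_intersect_iff [symmetric])
      show "\<bar>u - v\<bar> < 2 * pi" if "u \<in> {t i, x, t j, x}" "v \<in> {t i, x, t j, x}" for u v
        using range [OF i(1)] range [OF j(1)] x L(1) by (intro near_if_upper_half [OF _ that]) auto
    qed (use ne i j ij in \<open>auto simp: doubleton_eq_iff new\<close>)
    then show False by (simp add: sep_def)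
  qed
  have gen': "?E' e1 \<inter> ?E' e2 \<inter> ?E' e3 = {}"
    if e: "e1 \<in> index_pairs (Suc N)" "e2 \<in> index_pairs (Suc N)" "e3 \<in> index_pairs (Suc N)"
      and d: "e1 \<noteq> e2" "e1 \<noteq> e3" "e2 \<noteq> e3" for e1 e2 e3
  proof -
    consider "N \<in> e1" "N \<in> e2" | "N \<in> e1" "N \<in> e3" | "N \<in> e2" "N \<in> e3"
      | "N \<in> e1" "N \<notin> e2" "N \<notin> e3" | "N \<notin> e1" "N \<in> e2" "N \<notin> e3" | "N \<notin> e1" "N \<notin> e2" "N \<in> e3"
      | "N \<notin> e1" "N \<notin> e2" "N \<notin> e3" by blast
    then show ?thesis
    proof cases
      case 1 then show ?thesis using two [OF e(1,2)] d by blast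
    next
      case 2 then show ?thesis using two [OF e(1,3)] d by blast
    next
      case 3 then show ?thesis using two [OF e(2,3)] d by blast
    next
      case 4 then show ?thesis using one [OF e(1)] index_pairs_Suc(1) e d by blast
    next
      case 5 then show ?thesis using one [OF e(2), of e1 e3] index_pairs_Suc(1) e d by blast
    next
      case 6 then show ?thesis using one [OF e(3), of e1 e2] index_pairs_Suc(1) e d by blast
    next
      case 7
      then have "e1 \<in> index_pairs N" "e2 \<in> index_pairs N" "e3 \<in> index_pairs N"
        using index_pairs_Suc(1) e by blast+
      then show ?thesis using gen d by (simp add: old)
    qed
  qed
  have incr': "t' i < t' j" if "i < j" "j < Suc N" for i j
    using that incr [of i j] L(3) [of i] x(1) by (auto simp: t'_def less_Suc_eq)
  have range': "0 < t' i \<and> t' i < pi" if "i < Suc N" for i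
    using that range [of i] L(1) x by (auto simp: t'_def less_Suc_eq)
  show ?case
  proof (intro exI [of _ t'] conjI allI ballI impI)
    fix i j assume "i < j \<and> j < Suc N"
    then show "t' i < t' j" using incr' by simp
  next
    fix i assume "i < Suc N"
    then show "0 < t' i" "t' i < pi" using range' by simp_all
  next
    fix e1 e2 e3
    assume "e1 \<in> index_pairs (Suc N)" "e2 \<in> index_pairs (Suc N)" "e3 \<in> index_pairs (Suc N)"
      and "e1 \<noteq> e2 \<and> e1 \<noteq> e3 \<and> e2 \<noteq> e3"
    then show "?E' e1 \<inter> ?E' e2 \<inter> ?E' e3 = {}" using gen' by simp
  qed
qed

section \<open>Crossings of drawings\<close>

text \<open>Each doubleton comes from exactly two ordered pairs, distinct by irreflexivity. Used for
  edges as well as for pairs of edges.\<close>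

lemma sum_doubletons:
  fixes F :: "'a set \<Rightarrow> real"
  assumes fin: "finite X" and symR: "\<And>u v. R u v \<Longrightarrow> R v u" and irr: "\<And>u. \<not> R u u"
  shows "2 * (\<Sum>e\<in>{{u, v} | u v. u \<in> X \<and> v \<in> X \<and> R u v}. F e) =
    (\<Sum>u\<in>X. \<Sum>v\<in>X. of_bool (R u v) * F {u, v})"
proof -
  define Q where "Q = {q \<in> X \<times> X. R (fst q) (snd q)}"
  let ?g = "\<lambda>q. {fst q, snd q}"
  have finQ: "finite Q" unfolding Q_def using fin by simp
  have img: "?g ` Q = {{u, v} | u v. u \<in> X \<and> v \<in> X \<and> R u v}"
  proof (intro equalityI subsetI)
    fix e assume "e \<in> {{u, v} | u v. u \<in> X \<and> v \<in> X \<and> R u v}"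
    then obtain u v where "e = {u, v}" "u \<in> X" "v \<in> X" "R u v" by blast
    then show "e \<in> ?g ` Q" by (intro image_eqI [of _ _ "(u, v)"]) (auto simp: Q_def)
  qed (auto simp: Q_def, blast)
  have fib: "(\<Sum>q\<in>{q \<in> Q. ?g q = e}. F (?g q)) = 2 * F e" if e: "e \<in> ?g ` Q" for e
  proof -
    obtain u v where uv: "e = {u, v}" "u \<in> X" "v \<in> X" "R u v"
      using e unfolding img by blast
    have "{q \<in> Q. ?g q = e} = {(u, v), (v, u)}"
      using uv symR by (auto simp: Q_def doubleton_eq_iff)
    moreover have "(u, v) \<noteq> (v, u)" using uv irr by auto
    ultimately show ?thesis using uv by (simp add: insert_commute)
  qed
  have "(\<Sum>u\<in>X. \<Sum>v\<in>X. of_bool (R u v) * F {u, v}) =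
      (\<Sum>q\<in>X \<times> X. of_bool (R (fst q) (snd q)) * F (?g q))"
    unfolding sum.cartesian_product by (simp add: case_prod_beta)
  also have "\<dots> = (\<Sum>q\<in>Q. F (?g q))"
    unfolding Q_def using fin by (intro sum.mono_neutral_cong_right) auto
  also have "\<dots> = (\<Sum>e\<in>?g ` Q. \<Sum>q\<in>{q \<in> Q. ?g q = e}. F (?g q))"
    by (rule sum.image_gen [OF finQ])
  also have "\<dots> = (\<Sum>e\<in>?g ` Q. 2 * F e)"
    by (rule sum.cong [OF refl fib])
  finally show ?thesis
    unfolding img by (simp add: sum_distrib_left)
qed

lemma sum_swap_pairs:
  "(\<Sum>a\<in>A. \<Sum>b\<in>B. \<Sum>k\<in>C. \<Sum>l\<in>D. h a b k l) = (\<Sum>k\<in>C. \<Sum>l\<in>D. \<Sum>a\<in>A. \<Sum>b\<in>B. h a b k l)"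
proof -
  have "(\<Sum>a\<in>A. \<Sum>b\<in>B. \<Sum>k\<in>C. \<Sum>l\<in>D. h a b k l) = (\<Sum>a\<in>A. \<Sum>k\<in>C. \<Sum>b\<in>B. \<Sum>l\<in>D. h a b k l)"
    by (rule sum.cong [OF refl sum.swap])
  also have "\<dots> = (\<Sum>k\<in>C. \<Sum>a\<in>A. \<Sum>b\<in>B. \<Sum>l\<in>D. h a b k l)"
    by (rule sum.swap)
  also have "\<dots> = (\<Sum>k\<in>C. \<Sum>a\<in>A. \<Sum>l\<in>D. \<Sum>b\<in>B. h a b k l)"
    by (rule sum.cong [OF refl sum.cong [OF refl sum.swap]])
  also have "\<dots> = (\<Sum>k\<in>C. \<Sum>l\<in>D. \<Sum>a\<in>A. \<Sum>b\<in>B. h a b k l)"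
    by (rule sum.cong [OF refl sum.swap])
  finally show ?thesis .
qed

lemma sum_pairs_of_parts:
  fixes H :: "real \<Rightarrow> real \<Rightarrow> real" and V :: "(nat \<times> 'b) set"
  assumes fin: "finite V" and sub: "fst ` V \<subseteq> {..n}" and inj: "inj_on \<theta> V"
  defines "K \<equiv> \<lambda>i. \<theta> ` {v \<in> V. fst v = i}"
  shows "(\<Sum>u\<in>V. \<Sum>v\<in>V. of_bool (fst u \<noteq> fst v) * H (\<theta> u) (\<theta> v)) =
    (\<Sum>i\<le>n. \<Sum>j\<le>n. of_bool (i \<noteq> j) * (\<Sum>a\<in>K i. \<Sum>b\<in>K j. H a b))"
proof -
  let ?V = "\<lambda>i. {v \<in> V. fst v = i}"
  have inj': "inj_on \<theta> (?V i)" for i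
    by (rule inj_on_subset [OF inj]) auto
  have grp: "(\<Sum>u\<in>V. g u) = (\<Sum>i\<le>n. \<Sum>u\<in>?V i. g u)" for g :: "nat \<times> 'b \<Rightarrow> real"
    using sum.group [OF fin _ sub, of g] by simp
  have "(\<Sum>u\<in>V. \<Sum>v\<in>V. of_bool (fst u \<noteq> fst v) * H (\<theta> u) (\<theta> v)) =
      (\<Sum>u\<in>V. \<Sum>j\<le>n. \<Sum>v\<in>?V j. of_bool (fst u \<noteq> fst v) * H (\<theta> u) (\<theta> v))"
    by (rule sum.cong [OF refl grp])
  also have "\<dots> =
      (\<Sum>i\<le>n. \<Sum>u\<in>?V i. \<Sum>j\<le>n. \<Sum>v\<in>?V j. of_bool (fst u \<noteq> fst v) * H (\<theta> u) (\<theta> v))"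
    by (rule grp)
  also have "\<dots> = (\<Sum>i\<le>n. \<Sum>j\<le>n. \<Sum>u\<in>?V i. \<Sum>v\<in>?V j. of_bool (fst u \<noteq> fst v) * H (\<theta> u) (\<theta> v))"
    by (rule sum.cong [OF refl sum.swap])
  also have "\<dots> = (\<Sum>i\<le>n. \<Sum>j\<le>n. of_bool (i \<noteq> j) * (\<Sum>u\<in>?V i. \<Sum>v\<in>?V j. H (\<theta> u) (\<theta> v)))"
    by (intro sum.cong refl) (simp add: sum_distrib_left)
  also have "\<dots> = (\<Sum>i\<le>n. \<Sum>j\<le>n. of_bool (i \<noteq> j) * (\<Sum>a\<in>K i. \<Sum>b\<in>K j. H a b))"
    unfolding K_def by (simp only: sum.reindex [OF inj'] o_def)
  finally show ?thesis .
qed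

lemma finite_complete_multipartite: "finite (fst (complete_multipartite ks))"
proof -
  have "fst (complete_multipartite ks) = Sigma {..<length ks} (\<lambda>i. {..<ks ! i})"
    by (auto simp: complete_multipartite_def)
  then show ?thesis by simp
qed

lemma edges_complete_multipartite:
  "snd (complete_multipartite ks) = {{u, v} | u v. u \<in> fst (complete_multipartite ks) \<and>
     v \<in> fst (complete_multipartite ks) \<and> fst u \<noteq> fst v}"
  by (simp add: complete_multipartite_def Let_def)

text \<open>Doubling once for the pair of edges and once for each edge passes from unordered
  crossings to ordered quadruples of vertices; grouping these by parts gives
  \<open>crossing_sum\<close>.\<close>

lemma card_crossings_eq:
  fixes f :: "nat \<times> nat \<Rightarrow> complex"
  assumes len: "length ks = Suc n" and r: "r > 0"
    and f: "\<And>v. v \<in> fst (complete_multipartite ks) \<Longrightarrow> f v = c + of_real r * cis (\<theta> v)"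
    and inj: "inj_on \<theta> (fst (complete_multipartite ks))"
    and near: "\<And>u v. u \<in> fst (complete_multipartite ks) \<Longrightarrow> v \<in> fst (complete_multipartite ks) \<Longrightarrow>
      \<bar>\<theta> u - \<theta> v\<bar> < 2 * pi"
  shows "8 * real (card (crossings (complete_multipartite ks) f)) =
    crossing_sum n (\<lambda>i. \<theta> ` {v \<in> fst (complete_multipartite ks). fst v = i})"
proof -
  let ?G = "complete_multipartite ks"
  let ?V = "fst ?G" and ?E = "snd ?G"
  define pt where "pt = (\<lambda>\<alpha>. c + of_real r * cis \<alpha>)"
  interpret circle_points c r pt by unfold_locales (auto simp: r pt_def)
  define R where "R e1 e2 \<longleftrightarrow> e1 \<noteq> e2 \<and> open_edge f e1 \<inter> open_edge f e2 \<noteq> {}" for e1 e2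
  have finV: "finite ?V" by (rule finite_complete_multipartite)
  have finE: "finite ?E"
    unfolding edges_complete_multipartite by (rule finite_subset [of _ "Pow ?V"]) (use finV in auto)
  have edge_sum: "2 * (\<Sum>e\<in>?E. F e) = (\<Sum>u\<in>?V. \<Sum>v\<in>?V. of_bool (fst u \<noteq> fst v) * F {u, v})"
    for F :: "(nat \<times> nat) set \<Rightarrow> real"
    unfolding edges_complete_multipartite by (rule sum_doubletons [OF finV]) auto
  have crs: "crossings ?G f = {{e1, e2} | e1 e2. e1 \<in> ?E \<and> e2 \<in> ?E \<and> R e1 e2}"
    unfolding crossings_def R_def by simp
  have "2 * real (card (crossings ?G f)) = 2 * (\<Sum>e\<in>crossings ?G f. 1)" by simp
  also have "\<dots> = (\<Sum>e1\<in>?E. \<Sum>e2\<in>?E. of_bool (R e1 e2) * 1)"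
    unfolding crs by (rule sum_doubletons [OF finE]) (auto simp: R_def)
  finally have "8 * real (card (crossings ?G f)) = 2 * (\<Sum>e1\<in>?E. 2 * (\<Sum>e2\<in>?E. of_bool (R e1 e2)))"
    unfolding sum_distrib_left [symmetric] mult_1_right by linarith
  also have "\<dots> = (\<Sum>u\<in>?V. \<Sum>v\<in>?V. of_bool (fst u \<noteq> fst v) *
      (\<Sum>w\<in>?V. \<Sum>z\<in>?V. of_bool (fst w \<noteq> fst z) * of_bool (R {u, v} {w, z})))"
    unfolding edge_sum by (rule refl)
  also have "\<dots> = (\<Sum>u\<in>?V. \<Sum>v\<in>?V. of_bool (fst u \<noteq> fst v) *
      (\<Sum>w\<in>?V. \<Sum>z\<in>?V. of_bool (fst w \<noteq> fst z) * of_bool (sep (\<theta> u) (\<theta> v) (\<theta> w) (\<theta> z))))"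
  proof -
    have "R {u, v} {w, z} \<longleftrightarrow> sep (\<theta> u) (\<theta> v) (\<theta> w) (\<theta> z)"
      if V: "u \<in> ?V" "v \<in> ?V" "w \<in> ?V" "z \<in> ?V" and ne: "u \<noteq> v" "w \<noteq> z" for u v w z
    proof (cases "{u, v} = {w, z}")
      case True
      \<comment> \<open>An edge does not cross itself: \<open>R\<close> excludes equality, and the
        product in \<open>sep\<close> is zero.\<close>
      then show ?thesis by (auto simp: R_def doubleton_eq_iff sep_def)
    next
      case False
      have inj2: "\<theta> x = \<theta> y \<longleftrightarrow> x = y" if "x \<in> ?V" "y \<in> ?V" for x y
        using inj that by (auto dest: inj_onD)
      have "open_edge f {u, v} \<inter> open_edge f {w, z} =
          open_segment (pt (\<theta> u)) (pt (\<theta> v)) \<inter> open_segment (pt (\<theta> w)) (pt (\<theta> z))"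
        using V by (simp add: open_edge_doubleton f pt_def)
      moreover have "open_segment (pt (\<theta> u)) (pt (\<theta> v)) \<inter> open_segment (pt (\<theta> w)) (pt (\<theta> z)) \<noteq> {} \<longleftrightarrow>
          sep (\<theta> u) (\<theta> v) (\<theta> w) (\<theta> z)"
      proof (rule chords_intersect_iff)
        show "{\<theta> u, \<theta> v} \<noteq> {\<theta> w, \<theta> z}"
          using False V by (auto simp: doubleton_eq_iff inj2)
        show "\<bar>x - y\<bar> < 2 * pi" if "x \<in> {\<theta> u, \<theta> v, \<theta> w, \<theta> z}" "y \<in> {\<theta> u, \<theta> v, \<theta> w, \<theta> z}" for x y
        proof -
          have "x \<in> \<theta> ` ?V" "y \<in> \<theta> ` ?V" using that V by auto
          then show ?thesis using near by auto
        qed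
      qed (use V ne in \<open>simp_all add: inj2\<close>)
      ultimately show ?thesis using False by (simp add: R_def)
    qed
    note R_iff = this
    show ?thesis
    proof (intro sum.cong refl)
      fix u v assume uv: "u \<in> ?V" "v \<in> ?V"
      show "of_bool (fst u \<noteq> fst v) *
          (\<Sum>w\<in>?V. \<Sum>z\<in>?V. of_bool (fst w \<noteq> fst z) * of_bool (R {u, v} {w, z})) =
        (of_bool (fst u \<noteq> fst v) *
          (\<Sum>w\<in>?V. \<Sum>z\<in>?V. of_bool (fst w \<noteq> fst z) * of_bool (sep (\<theta> u) (\<theta> v) (\<theta> w) (\<theta> z))) :: real)"
      proof (cases "fst u = fst v")
        case False
        have *: "of_bool (fst w \<noteq> fst z) * of_bool (R {u, v} {w, z}) =
            (of_bool (fst w \<noteq> fst z) * of_bool (sep (\<theta> u) (\<theta> v) (\<theta> w) (\<theta> z)) :: real)"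
          if "w \<in> ?V" "z \<in> ?V" for w z
        proof (cases "fst w = fst z")
          case wz: False
          have "u \<noteq> v" "w \<noteq> z" using False wz by auto
          then show ?thesis using R_iff [OF uv that] by simp
        qed simp
        show ?thesis
          by (rule arg_cong [where f = "(*) _"], rule sum.cong [OF refl], rule sum.cong [OF refl], rule *)
      qed simp
    qed
  qed
  also have "\<dots> = crossing_sum n (\<lambda>i. \<theta> ` {v \<in> ?V. fst v = i})"
  proof -
    have sub: "fst ` ?V \<subseteq> {..n}"
      using len by (auto simp: complete_multipartite_def)
    note P = sum_pairs_of_parts [OF finV sub inj]
    let ?K = "\<lambda>i. \<theta> ` {v \<in> ?V. fst v = i}"
    have "(\<Sum>u\<in>?V. \<Sum>v\<in>?V. of_bool (fst u \<noteq> fst v) *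
        (\<Sum>w\<in>?V. \<Sum>z\<in>?V. of_bool (fst w \<noteq> fst z) * of_bool (sep (\<theta> u) (\<theta> v) (\<theta> w) (\<theta> z)))) =
      (\<Sum>u\<in>?V. \<Sum>v\<in>?V. of_bool (fst u \<noteq> fst v) *
        (\<Sum>k\<le>n. \<Sum>l\<le>n. of_bool (k \<noteq> l) * (\<Sum>c\<in>?K k. \<Sum>d\<in>?K l. of_bool (sep (\<theta> u) (\<theta> v) c d) :: real)))"
      by (simp only: P [of "\<lambda>c d. of_bool (sep _ _ c d)"])
    also have "\<dots> = (\<Sum>i\<le>n. \<Sum>j\<le>n. of_bool (i \<noteq> j) * (\<Sum>a\<in>?K i. \<Sum>b\<in>?K j.
        (\<Sum>k\<le>n. \<Sum>l\<le>n. of_bool (k \<noteq> l) * (\<Sum>c\<in>?K k. \<Sum>d\<in>?K l. of_bool (sep a b c d)))))"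
      by (rule P)
    also have "\<dots> = (\<Sum>i\<le>n. \<Sum>j\<le>n. of_bool (i \<noteq> j) *
        (\<Sum>k\<le>n. \<Sum>l\<le>n. of_bool (k \<noteq> l) * nsep (?K i) (?K j) (?K k) (?K l)))"
      by (subst sum_swap_pairs) (simp only: nsep_def sum_distrib_left)
    also have "\<dots> = crossing_sum n ?K"
      unfolding crossing_sum_def sum_distrib_left by (intro sum.cong refl) (simp add: of_bool_conj)
    finally show ?thesis .
  qed
  finally show ?thesis .
qed

lemma vertex_iff:
  "(i, j) \<in> fst (complete_multipartite (p # replicate n m)) \<longleftrightarrow> i = 0 \<and> j < p \<or> i \<in> {1..n} \<and> j < m"
  by (cases i) (auto simp: complete_multipartite_def)

lemma part_eq:
  "{v \<in> fst (complete_multipartite (p # replicate n m)). fst v = i} =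
    {i} \<times> {..<if i = 0 then p else if i \<le> n then m else 0}"
  by (auto simp: vertex_iff split: if_splits)

lemma point_parts_if_inj:
  assumes inj: "inj_on \<theta> (fst (complete_multipartite (p # replicate n m)))" and "m > 0" "p > 0"
  shows "point_parts (\<lambda>i. \<theta> ` {v \<in> fst (complete_multipartite (p # replicate n m)). fst v = i}) m n p"
proof
  let ?V = "fst (complete_multipartite (p # replicate n m))"
  have c: "card (\<theta> ` {v \<in> ?V. fst v = i}) = (if i = 0 then p else if i \<le> n then m else 0)" for i
  proof -
    have "inj_on \<theta> {v \<in> ?V. fst v = i}" by (rule inj_on_subset [OF inj]) auto
    then show ?thesis by (simp only: card_image part_eq) (simp add: card_cartesian_product_singleton)
  qed
  show "finite (\<theta> ` {v \<in> ?V. fst v = i})" for i by (simp add: part_eq)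
  show "card (\<theta> ` {v \<in> ?V. fst v = 0}) = p" by (simp add: c)
  show "card (\<theta> ` {v \<in> ?V. fst v = i}) = m" if "i \<in> {1..n}" for i using that by (simp add: c)
  show "\<theta> ` {v \<in> ?V. fst v = i} \<inter> \<theta> ` {v \<in> ?V. fst v = j} = {}" if "i \<noteq> j" for i j
    using that inj by (auto dest: inj_onD)
qed (use assms in auto)

section \<open>The extremal arrangement\<close>

lemma below_image:
  assumes "inj_on a {..<m}"
  shows "below (a ` {..<m}) x = card {j. j < m \<and> a j < x}"
proof -
  have "{v \<in> a ` {..<m}. v < x} = a ` {j. j < m \<and> a j < x}" by auto
  then show ?thesis
    unfolding below_def using assms by (simp add: card_image inj_on_def)
qed

text \<open>The hypotheses say a 0 < b 0 < a 1 < b 1 < ...; this produces the alternation hypotheses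
  of \<open>crossing_sum_eq_bound\<close>.\<close>

lemma below_interlacing:
  fixes a b :: "nat \<Rightarrow> real"
  assumes a: "\<And>i j. i < j \<Longrightarrow> j < m \<Longrightarrow> a i < a j" and b: "\<And>i j. i < j \<Longrightarrow> j < m \<Longrightarrow> b i < b j"
    and ab: "\<And>j. j < m \<Longrightarrow> a j < b j" and ba: "\<And>i j. i < j \<Longrightarrow> j < m \<Longrightarrow> b i < a j"
  defines "A \<equiv> a ` {..<m}" and "B \<equiv> b ` {..<m}"
  shows "below A x = below B x \<or> below A x = below B x + 1"
    and "x \<in> A \<Longrightarrow> below A x = below B x"
    and "x \<in> B \<Longrightarrow> below A x = below B x + 1"
proof -
  have inj: "inj_on a {..<m}" "inj_on b {..<m}"
    by (rule linorder_inj_onI'; use a b in force)+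
  have A: "below A x = card {j. j < m \<and> a j < x}" and B: "below B x = card {j. j < m \<and> b j < x}" for x
    unfolding A_def B_def using inj by (simp_all add: below_image)
  have "{j. j < m \<and> b j < x} \<subseteq> {j. j < m \<and> a j < x}" using ab by force
  then have 1: "below B x \<le> below A x" unfolding A B by (intro card_mono) auto
  \<comment> \<open>Every a j below x except possibly a 0 has its predecessor b (j - 1) below x, so
    A is at most one ahead of B.\<close>
  have "{j. j < m \<and> a j < x} \<subseteq> insert 0 (Suc ` {j. j < m \<and> b j < x})"
  proof
    fix j assume j: "j \<in> {j. j < m \<and> a j < x}"
    show "j \<in> insert 0 (Suc ` {j. j < m \<and> b j < x})"
    proof (cases j)
      case (Suc i)
      then have "b i < x" using j ba [of i j] by auto
      then show ?thesis using Suc j by auto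
    qed simp
  qed
  then have "below A x \<le> card (insert 0 (Suc ` {j. j < m \<and> b j < x}))"
    unfolding A by (intro card_mono) auto
  also have "\<dots> = below B x + 1" unfolding B by (simp add: card_image)
  finally show "below A x = below B x \<or> below A x = below B x + 1" using 1 by linarith
  have le: "a i < a j \<longleftrightarrow> i < j" "b i < b j \<longleftrightarrow> i < j" "b i < a j \<longleftrightarrow> i < j" "a i < b j \<longleftrightarrow> i \<le> j"
    if "i < m" "j < m" for i j
    using a [of i j] a [of j i] b [of i j] b [of j i] ab [of i] ab [of j] ba [of i j] ba [of j i] that
    by (cases i j rule: linorder_cases; force)+
  show "below A x = below B x" if x: "x \<in> A"
  proof -
    obtain j where j: "j < m" "x = a j" using x by (auto simp: A_def)
    have "{i. i < m \<and> a i < x} = {i. i < m \<and> b i < x}" using j le by auto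
    then show ?thesis unfolding A B by simp
  qed
  show "below A x = below B x + 1" if x: "x \<in> B"
  proof -
    obtain j where j: "j < m" "x = b j" using x by (auto simp: B_def)
    have "{i. i < m \<and> a i < x} = {..j}" "{i. i < m \<and> b i < x} = {..<j}" using j le by auto
    then show ?thesis unfolding A B by simp
  qed
qed

text \<open>The sets of equal size repeat cyclically on the odd positions; the \<open>p\<close> vertices of the first
  set are spread evenly over the even positions.\<close>

definition position :: "nat \<Rightarrow> nat \<Rightarrow> nat \<Rightarrow> nat \<times> nat \<Rightarrow> nat" where
  "position m n p v = (if fst v = 0 then 2 * (snd v * (m * n div p)) else 2 * (snd v * n + (fst v - 1)) + 1)"

context
  fixes m n p :: nat
  assumes pos: "m > 0" "n > 0" "p > 0" and dvd: "p dvd m * n"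
begin

private abbreviation (input) "G \<equiv> complete_multipartite (p # replicate n m)"

lemma quotient: "p * (m * n div p) = m * n" "m * n div p > 0"
proof -
  show *: "p * (m * n div p) = m * n" using dvd by simp
  have "m * n > 0" using pos by simp
  then show "m * n div p > 0" using * by (metis gr0I mult_0_right less_irrefl)
qed

text \<open>Parity separates the first part from the others. Within the first part the spacing is
  positive; elsewhere division by n with remainder recovers both indices.\<close>

lemma inj_position: "inj_on (position m n p) (fst G)"
proof (rule inj_onI)
  fix u v assume uv: "u \<in> fst G" "v \<in> fst G" and eq: "position m n p u = position m n p v"
  obtain i j k l where ij: "u = (i, j)" "v = (k, l)" by (metis surj_pair)
  have par: "odd (position m n p w) \<longleftrightarrow> fst w \<noteq> 0" for w
    by (simp add: position_def)
  have "i = 0 \<longleftrightarrow> k = 0" using par [of u] par [of v] eq ij by auto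
  show "u = v"
  proof (cases "i = 0")
    case True
    then show ?thesis using eq ij \<open>i = 0 \<longleftrightarrow> k = 0\<close> quotient(2) by (simp add: position_def)
  next
    case False
    then have *: "j * n + (i - 1) = l * n + (k - 1)" "i - 1 < n" "k - 1 < n" "k \<noteq> 0"
      using eq ij uv \<open>i = 0 \<longleftrightarrow> k = 0\<close> by (auto simp: position_def vertex_iff)
    have "(a * n + d) div n = a" if "d < n" for a d using that by simp
    then have "j = l" using *(1-3) by metis
    then show ?thesis using * False ij by simp
  qed
qed

lemma position_less: "v \<in> fst G \<Longrightarrow> position m n p v < 2 * (m * n)"
proof -
  assume v: "v \<in> fst G"
  obtain i j where ij: "v = (i, j)" by (metis surj_pair)
  show ?thesis
  proof (cases "i = 0")
    case True
    then have "j < p" using v ij by (simp add: vertex_iff)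
    then have "j * (m * n div p) < p * (m * n div p)" using quotient(2) by simp
    then show ?thesis using True ij quotient(1) by (simp add: position_def)
  next
    case False
    then have "j < m" "i - 1 < n" using v ij by (auto simp: vertex_iff)
    then have "j * n + (i - 1) < j * n + n" by simp
    also have "\<dots> = Suc j * n" by simp
    also have "\<dots> \<le> m * n" using \<open>j < m\<close> by (intro mult_right_mono) auto
    finally show ?thesis using False ij by (simp add: position_def)
  qed
qed

text \<open>Any increasing placement of the 2 m n slots: the count depends on their order alone, so
  general position can be arranged separately.\<close>

context
  fixes t :: "nat \<Rightarrow> real"
  assumes t: "\<And>i j. i < j \<Longrightarrow> j < 2 * (m * n) \<Longrightarrow> t i < t j"
begin

lemma t_less_iff: "i < 2 * (m * n) \<Longrightarrow> j < 2 * (m * n) \<Longrightarrow> t i < t j \<longleftrightarrow> i < j"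
  using t [of i j] t [of j i] by (cases i j rule: linorder_cases) auto

lemma inj_angle: "inj_on (\<lambda>v. t (position m n p v)) (fst G)"
proof (rule inj_onI)
  fix u v assume uv: "u \<in> fst G" "v \<in> fst G" and eq: "t (position m n p u) = t (position m n p v)"
  have "position m n p u = position m n p v"
    using t_less_iff [OF position_less position_less] uv eq
    by (metis less_irrefl linorder_neqE_nat)
  then show "u = v" using inj_position uv by (auto dest: inj_onD)
qed

lemma crossing_sum_position:
  "crossing_sum n (\<lambda>i. (\<lambda>v. t (position m n p v)) ` {v \<in> fst G. fst v = i}) =
    point_parts.crossing_bound m n p"
proof -
  define q where "q = m * n div p"
  define K where "K = (\<lambda>i. (\<lambda>v. t (position m n p v)) ` {v \<in> fst G. fst v = i})"
  interpret point_parts K m n p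
    unfolding K_def using inj_angle pos by (intro point_parts_if_inj) auto
  have K0: "K 0 = (\<lambda>j. t (2 * (j * q))) ` {..<p}"
    unfolding K_def part_eq q_def by (auto simp: position_def image_iff)
  have Ki: "K i = (\<lambda>j. t (2 * (j * n + (i - 1)) + 1)) ` {..<m}" if "i \<in> {1..n}" for i
    using that unfolding K_def part_eq by (auto simp: position_def image_iff)
  \<comment> \<open>The parts of size m fill the odd slots completely: slot 2 s + 1 belongs to part
    s mod n + 1 in round s div n.\<close>
  have S: "S = (\<lambda>s. t (2 * s + 1)) ` {..<m * n}"
  proof (intro equalityI subsetI)
    fix x assume "x \<in> S"
    then obtain i where i0: "i \<in> {1..n}" "x \<in> K i" by (auto simp: S_def)
    then obtain v where i: "i \<in> {1..n}" "v \<in> fst G" "fst v = i" "x = t (position m n p v)"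
      by (auto simp: K_def)
    then have e: "position m n p v = 2 * (snd v * n + (i - 1)) + 1"
      by (auto simp: position_def)
    have "snd v * n + (i - 1) < m * n" using position_less [OF i(2)] e by simp
    then show "x \<in> (\<lambda>s. t (2 * s + 1)) ` {..<m * n}"
      by (intro image_eqI [of _ _ "snd v * n + (i - 1)"]) (auto simp: i(4) e)
  next
    fix x assume "x \<in> (\<lambda>s. t (2 * s + 1)) ` {..<m * n}"
    then obtain s where s: "s < m * n" "x = t (2 * s + 1)" by auto
    have "s div n < m" using s(1) by (simp add: less_mult_imp_div_less)
    moreover have i: "Suc (s mod n) \<in> {1..n}" using pos by (simp add: Suc_leI)
    moreover have "x = t (2 * (s div n * n + (Suc (s mod n) - 1)) + 1)"
      by (simp only: s(2) diff_Suc_1 div_mult_mod_eq)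
    ultimately have "x \<in> K (Suc (s mod n))" unfolding Ki [OF i] by blast
    then show "x \<in> S" unfolding S_def using i by blast
  qed
  have odd_less: "2 * (j * n + (i - 1)) + 1 < 2 * (m * n)" if "i \<in> {1..n}" "j < m" for i j
    using position_less [of "(i, j)"] that by (simp add: position_def vertex_iff)
  have even_less: "2 * (j * q) < 2 * (m * n)" if "j < p" for j
    using position_less [of "(0, j)"] that by (simp add: position_def vertex_iff q_def)
  have "crossing_sum n K = crossing_bound"
  proof (rule crossing_sum_eq_bound)
    fix x assume "x \<in> K 0"
    then obtain j where j: "j < p" "x = t (2 * (j * q))" by (auto simp: K0)
    have q: "q > 0" "p * q = m * n" using quotient by (auto simp: q_def)
    have "inj_on (\<lambda>j. t (2 * (j * q))) {..<p}"
      by (rule linorder_inj_onI') (use t even_less q(1) in \<open>force simp: less_imp_neq\<close>)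
    then have "below (K 0) x = card {i. i < p \<and> t (2 * (i * q)) < x}"
      unfolding K0 by (rule below_image)
    also have "{i. i < p \<and> t (2 * (i * q)) < x} = {..<j}"
    proof -
      have "t (2 * (i * q)) < x \<longleftrightarrow> i < j" if "i < p" for i
        using t_less_iff [OF even_less [OF that] even_less [OF j(1)]] j(2) q(1) by simp
      then show ?thesis using j(1) by auto
    qed
    finally have 1: "below (K 0) x = j" by simp
    have "inj_on (\<lambda>s. t (2 * s + 1)) {..<m * n}"
      by (rule linorder_inj_onI') (use t in \<open>force simp: less_imp_neq\<close>)
    then have "below S x = card {s. s < m * n \<and> t (2 * s + 1) < x}"
      unfolding S by (rule below_image)
    \<comment> \<open>Exactly the odd slots with s < j q precede slot 2 j q. Since p divides m n, q
      is exactly m n / p and the spread is perfectly even.\<close>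
    also have "{s. s < m * n \<and> t (2 * s + 1) < x} = {..<j * q}"
      using j even_less [OF j(1)] by (auto simp: t_less_iff)
    finally have 2: "below S x = j * q" by simp
    show "real (below S x) = real (below (K 0) x) * real (m * n) / real p"
      unfolding 1 2 q(2) [symmetric] using pos by simp
  next
    fix i k and x :: real assume ik: "1 \<le> i" "i < k" "k \<le> n"
    define a where "a = (\<lambda>j. t (2 * (j * n + (i - 1)) + 1))"
    define b where "b = (\<lambda>j. t (2 * (j * n + (k - 1)) + 1))"
    have KK: "K i = a ` {..<m}" "K k = b ` {..<m}"
      using ik by (simp_all add: Ki a_def b_def)
    \<comment> \<open>Every slot of a round precedes all slots of later rounds.\<close>
    have step: "j * n + d < j' * n + d'" if "j < j'" "d < n" for j j' d d'
    proof -
      have "j * n + d < Suc j * n" using that by simp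
      also have "\<dots> \<le> j' * n" using that by (intro mult_right_mono) auto
      finally show ?thesis by simp
    qed
    have ai: "a j < a j'" "b j < b j'" "b j < a j'" if "j < j'" "j' < m" for j j'
      unfolding a_def b_def using that ik step [of j j' "i - 1" "i - 1"] step [of j j' "k - 1" "k - 1"]
        step [of j j' "k - 1" "i - 1"] odd_less [of i j'] odd_less [of k j'] by (auto intro!: t)
    have ab: "a j < b j" if "j < m" for j
      unfolding a_def b_def using that ik odd_less [of k j] by (intro t) auto
    show "below (K i) x = below (K k) x \<or> below (K i) x = below (K k) x + 1"
      unfolding KK by (rule below_interlacing(1)) (simp_all add: ai ab)
    show "below (K i) x = below (K k) x" if "x \<in> K i"
      using that unfolding KK by (intro below_interlacing(2)) (simp_all add: ai ab)
    show "below (K i) x = below (K k) x + 1" if "x \<in> K k"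
      using that unfolding KK by (intro below_interlacing(3)) (simp_all add: ai ab)
  qed
  then show ?thesis unfolding K_def .
qed

end

text \<open>The vertices occupy some of the slots in general position. As \<open>position\<close> is
  injective, distinct edges give distinct chords, so no three edges have a common point.\<close>

lemma optimal_drawing_exists:
  "\<exists>f. outerplanar_drawing G f \<and> 8 * real (card (crossings G f)) = point_parts.crossing_bound m n p"
proof -
  obtain t :: "nat \<Rightarrow> real" where incr: "\<And>i j. i < j \<Longrightarrow> j < 2 * (m * n) \<Longrightarrow> t i < t j"
    and range: "\<And>i. i < 2 * (m * n) \<Longrightarrow> 0 < t i \<and> t i < pi"
    and gen: "\<And>e1 e2 e3. e1 \<in> index_pairs (2 * (m * n)) \<Longrightarrow> e2 \<in> index_pairs (2 * (m * n)) \<Longrightarrow>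
        e3 \<in> index_pairs (2 * (m * n)) \<Longrightarrow> e1 \<noteq> e2 \<Longrightarrow> e1 \<noteq> e3 \<Longrightarrow> e2 \<noteq> e3 \<Longrightarrow>
        open_edge (\<lambda>i. cis (t i)) e1 \<inter> open_edge (\<lambda>i. cis (t i)) e2 \<inter> open_edge (\<lambda>i. cis (t i)) e3 = {}"
    using generic_angles_exist [of "2 * (m * n)"] by metis
  define \<theta> where "\<theta> = (\<lambda>v. t (position m n p v))"
  define f where "f = (\<lambda>v. cis (\<theta> v))"
  have inj: "inj_on \<theta> (fst G)" unfolding \<theta>_def by (rule inj_angle [OF incr])
  have near: "\<bar>\<theta> u - \<theta> v\<bar> < 2 * pi" if "u \<in> fst G" "v \<in> fst G" for u v
  proof (rule near_if_upper_half)
    show "{\<theta> u, \<theta> v} \<subseteq> {0<..<pi}" using that range position_less by (auto simp: \<theta>_def)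
  qed auto
  have edge: "position m n p ` e \<in> index_pairs (2 * (m * n))"
    "open_edge f e = open_edge (\<lambda>i. cis (t i)) (position m n p ` e)" "e \<subseteq> fst G"
    if e: "e \<in> snd G" for e
  proof -
    obtain u v where uv: "e = {u, v}" "u \<in> fst G" "v \<in> fst G" "u \<noteq> v"
      using e unfolding edges_complete_multipartite by blast
    have "position m n p u \<noteq> position m n p v" using inj_position uv by (auto dest: inj_onD)
    moreover have "position m n p ` e = {position m n p u, position m n p v}" using uv(1) by simp
    ultimately show "position m n p ` e \<in> index_pairs (2 * (m * n))"
      unfolding index_pairs_def using position_less [OF uv(2)] position_less [OF uv(3)] by blast
    show "open_edge f e = open_edge (\<lambda>i. cis (t i)) (position m n p ` e)" "e \<subseteq> fst G"
      using uv by (simp_all add: open_edge_doubleton f_def \<theta>_def)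
  qed
  have "outerplanar_drawing G f"
    unfolding outerplanar_drawing_def
  proof (intro conjI ballI impI)
    show "inj_on f (fst G)"
    proof (rule inj_onI, rule ccontr)
      fix u v assume uv: "u \<in> fst G" "v \<in> fst G" "f u = f v" "u \<noteq> v"
      then have "\<theta> u \<noteq> \<theta> v" using inj by (auto dest: inj_onD)
      then have "cis (\<theta> u) \<noteq> cis (\<theta> v)" using near uv by (intro unit_circle.pt_neq)
      then show False using uv by (simp add: f_def)
    qed
    show "\<exists>c r. 0 < r \<and> f ` fst G \<subseteq> sphere c r"
      by (intro exI [of _ 0] exI [of _ 1]) (auto simp: f_def)
    fix e1 e2 e3 assume e: "e1 \<in> snd G" "e2 \<in> snd G" "e3 \<in> snd G"
      and d: "e1 \<noteq> e2 \<and> e1 \<noteq> e3 \<and> e2 \<noteq> e3"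
    have "position m n p ` e \<noteq> position m n p ` e'" if "e \<in> snd G" "e' \<in> snd G" "e \<noteq> e'" for e e'
      using inj_on_image_eq_iff [OF inj_position, of e e'] edge(3) that by simp
    then show "open_edge f e1 \<inter> open_edge f e2 \<inter> open_edge f e3 = {}"
      using e d by (simp only: edge(2)) (intro gen edge(1), auto)
  qed
  moreover have "8 * real (card (crossings G f)) = crossing_sum n (\<lambda>i. \<theta> ` {v \<in> fst G. fst v = i})"
    by (rule card_crossings_eq [where r = 1 and c = 0]) (use inj near in \<open>auto simp: f_def\<close>)
  ultimately show ?thesis
    using crossing_sum_position [of t, OF incr] unfolding \<theta>_def by auto
qed

end

section \<open>The lower bound for arbitrary drawings and the crossing number\<close>

lemma crossings_lower_bound:
  assumes "outerplanar_drawing (complete_multipartite (p # replicate n m)) f" "m > 0" "p > 0"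
  shows "point_parts.crossing_bound m n p \<le>
    8 * real (card (crossings (complete_multipartite (p # replicate n m)) f))"
proof -
  let ?G = "complete_multipartite (p # replicate n m)"
  obtain c r where r: "r > 0" "f ` fst ?G \<subseteq> sphere c r" and injf: "inj_on f (fst ?G)"
    using assms by (auto simp: outerplanar_drawing_def)
  define \<theta> where "\<theta> = (\<lambda>v. Arg (f v - c))"
  have f: "f v = c + of_real r * cis (\<theta> v)" if "v \<in> fst ?G" for v
  proof -
    have "norm (f v - c) = r" using r that by (auto simp: dist_norm norm_minus_commute)
    then have "f v - c = of_real r * cis (\<theta> v)"
      unfolding \<theta>_def using rcis_cmod_Arg [of "f v - c"] by (simp add: rcis_def)
    then show ?thesis by (simp add: algebra_simps)
  qed
  have inj: "inj_on \<theta> (fst ?G)"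
    by (rule inj_onI) (metis f inj_onD [OF injf])
  have near: "\<bar>\<theta> u - \<theta> v\<bar> < 2 * pi" for u v
    \<comment> \<open>\<open>Arg\<close> takes values in (-pi, pi], half open, so differences stay
      strictly below 2 pi.\<close>
    using Arg_bounded [of "f u - c"] Arg_bounded [of "f v - c"] unfolding \<theta>_def by linarith
  interpret point_parts "\<lambda>i. \<theta> ` {v \<in> fst ?G. fst v = i}" m n p
    using inj assms by (intro point_parts_if_inj)
  have "8 * real (card (crossings ?G f)) = crossing_sum n (\<lambda>i. \<theta> ` {v \<in> fst ?G. fst v = i})"
    using r f inj near by (intro card_crossings_eq) auto
  then show ?thesis using crossing_bound_le by simp
qed

theorem theorem1:
  fixes m n p :: nat
  assumes "m > 0" and "n > 0" and "p > 0" and "p dvd m * n"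
  shows "real (outerplanar_crossing_number (complete_multipartite (p # replicate n m))) =
      1/24 * real m ^ 4 * real n ^ 4 + 1/12 * real m ^ 2 * real n ^ 3
    - 1/12 * real m ^ 4 * real n ^ 3 - 1/4 * real m ^ 3 * real n ^ 3
    + 1/2 * real m ^ 3 * real n ^ 2 + 1/24 * real m ^ 4 * real n ^ 2
    - 1/4 * real m ^ 3 * real n
    + 1/6 * real m ^ 2 * real n ^ 2 * real p ^ 2 - 1/4 * real p ^ 2 * real m * real n
    - 3/4 * real m ^ 2 * real n ^ 2 * real p
    + 1/12 * real m * real n * real p + 1/2 * real m ^ 2 * real n * real p
    - 1/6 * real m ^ 3 * real n ^ 2 * real p
    + 1/6 * real m ^ 3 * real n ^ 3 * real p
    + 1/6 * real m * real n ^ 2 * real p"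
proof -
  let ?G = "complete_multipartite (p # replicate n m)"
  obtain f where f: "outerplanar_drawing ?G f"
      "8 * real (card (crossings ?G f)) = point_parts.crossing_bound m n p"
    using optimal_drawing_exists [OF assms] by blast
  have "outerplanar_crossing_number ?G = card (crossings ?G f)"
    unfolding outerplanar_crossing_number_def
  proof (rule Least_equality)
    show "\<exists>g. outerplanar_drawing ?G g \<and> card (crossings ?G g) = card (crossings ?G f)"
      using f(1) by blast
    fix k assume "\<exists>g. outerplanar_drawing ?G g \<and> card (crossings ?G g) = k"
    then show "card (crossings ?G f) \<le> k"
      using crossings_lower_bound [of p n m] assms f(2) by fastforce
  qed
  \<comment> \<open>The polynomial form of the bound is a fact of \<open>point_parts\<close>, so an
    instance with these sizes is needed; the slot numbers read as reals provide one.\<close>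
  moreover have "inj_on (\<lambda>v. real (position m n p v)) (fst ?G)"
    using inj_position [OF assms] by (simp add: inj_on_def)
  then interpret point_parts "\<lambda>i. (\<lambda>v. real (position m n p v)) ` {v \<in> fst ?G. fst v = i}" m n p
    using assms by (intro point_parts_if_inj)
  have "8 * real (card (crossings ?G f)) = crossing_bound" by (rule f(2))
  ultimately show ?thesis
    unfolding crossing_bound_polynomial mult_cancel_left by simp
qed

end
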